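(* Let $n,d\ge1$. For generic $P\in\mathrm{PC}_{n,d}$ (i.e. there is a proper algebraic subset $A\subset\mathbb{R}^{nd}$ such that the following holds for all $P\in\mathrm{PC}_{n,d}\setminus A$): $P$ is locally identifiable up to isometry under Vietoris–Rips persistence if and only if the framework $(G_P,P)$ is rigid.
   Context: Fix a field $\mathbb{F}$; homology is over $\mathbb{F}$. $\mathrm{PC}_{n,d}=\{(p_1,\dots,p_n)\in\mathbb{R}^{nd}: p_i\in\mathbb{R}^d,\ p_i\ne p_j \text{ for } i\neq j\}$ is the space of point clouds; $[n]=\{1,\dots,n\}$. Barcodes: a barcode is a multiset of nonempty intervals in $\mathbb{R}$; a full barcode is a sequence $D=(D_i)_{i\ge0}$ of barcodes. For $P\in\mathrm{PC}_{n,d}$, the Vietoris–Rips filtration is $\mathrm{VR}(P,r)=\{\emptyset\ne\sigma\subseteq[n]:\|p_i-p_j\|\le 2r\ \forall i,j\in\sigma\}$, $r\in\mathbb{R}$ (empty for $r<0$). $\mathrm{PH}(P)=\mathrm{PH}^{\mathrm{VR}}(P)=(D_i)_{i\ge0}$ is the full barcode where $D_i$ is the unique finite multiset of nonempty intervals with $\{H_i(\mathrm{VR}(P,r))\}_{r}\cong\bigoplus_{I\in D_i}\chi_I$ as persistence modules, $\chi_I$ being the interval module of $I$. Critical graph: for $P=(p_1,\dots,p_n)$ with $D=\mathrm{PH}(P)$ and $i\ne j$, the pair $\{i,j\}$ is a critical edge if $\frac12\|p_i-p_j\|$ is a bounded (i.e. real-valued) endpoint of some interval in some $D_\ell$. $G_P$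 is the graph with vertex set $[n]$ whose edges are the critical edges of $P$. Rigidity: $P,Q$ are congruent if $\|p_i-p_j\|=\|q_i-q_j\|$ for all $i,j\in[n]$. For a graph $G$ on $[n]$ and $P\in(\mathbb{R}^d)^n$, the framework $(G,P)$ is (locally) rigid if there is a neighborhood $U$ of $P$ such that every $Q\in U$ with $\|q_i-q_j\|=\|p_i-p_j\|$ for all edges $\{i,j\}$ of $G$ is congruent to $P$. Local identifiability: $P,Q\in\mathrm{PC}_{n,d}$ are isometric if there is a permutation $f$ of $[n]$ with $\|p_i-p_j\|=\|q_{f(i)}-q_{f(j)}\|$ for all $i,j$. $P$ is locally identifiable up to isometry under Vietoris–Rips persistence if there is a neighborhood $U$ of $P$ in $\mathrm{PC}_{n,d}$ such that every $Q\in U$ with $\mathrm{PH}(Q)=\mathrm{PH}(P)$ is isometric to $P$. *)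

theory Defs
  imports "HOL-Analysis.Analysis" "HOL-Library.Multiset" "HOL-Library.FuncSet"
    "HOL-Library.Set_Algebras"
begin

text \<open>
  A point cloud of \<open>n\<close> points in \<open>\<real>\<^sup>d\<close> is an element of \<open>real ^ 'd ^ 'n\<close> with \<open>n = CARD('n)\<close> and
  \<open>d = CARD('d)\<close>; this type is the Euclidean space of dimension \<open>n * d\<close>. The index type \<open>'n\<close> is
  linearly ordered, as \<open>{1, ..., n}\<close> is; the order only enters through the orientation of
  simplices. Homology is taken over the field \<open>'k\<close>.
\<close>

definition point_clouds :: "(real ^ 'd ^ 'n) set" where
  "point_clouds = {P. \<forall>i j. i \<noteq> j \<longrightarrow> P $ i \<noteq> P $ j}"

definition algebraic_set :: "'a::real_normed_vector set \<Rightarrow> bool" where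
  "algebraic_set A \<longleftrightarrow>
    (\<exists>F. finite F \<and> (\<forall>f\<in>F. real_polynomial_function f) \<and> A = {x. \<forall>f\<in>F. f x = 0})"


subsection \<open>Persistence modules\<close>

text \<open>
  The vector space of a persistence module at each parameter is given by a carrier and its
  operations, because homology groups are sets of cosets and not subspaces of an ambient space.
\<close>

record ('k, 'v) pers_module =
  pm_carrier :: "real \<Rightarrow> 'v set"
  pm_add :: "real \<Rightarrow> 'v \<Rightarrow> 'v \<Rightarrow> 'v"
  pm_scale :: "real \<Rightarrow> 'k \<Rightarrow> 'v \<Rightarrow> 'v"
  pm_map :: "real \<Rightarrow> real \<Rightarrow> 'v \<Rightarrow> 'v"

definition pers_iso :: "('k, 'v) pers_module \<Rightarrow> ('k, 'w) pers_module \<Rightarrow> bool" where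
  "pers_iso M N \<longleftrightarrow> (\<exists>\<phi>.
    (\<forall>r. bij_betw (\<phi> r) (pm_carrier M r) (pm_carrier N r)) \<and>
    (\<forall>r. \<forall>x\<in>pm_carrier M r. \<forall>y\<in>pm_carrier M r.
       \<phi> r (pm_add M r x y) = pm_add N r (\<phi> r x) (\<phi> r y)) \<and>
    (\<forall>r c. \<forall>x\<in>pm_carrier M r. \<phi> r (pm_scale M r c x) = pm_scale N r c (\<phi> r x)) \<and>
    (\<forall>r s. r \<le> s \<longrightarrow>
       (\<forall>x\<in>pm_carrier M r. \<phi> s (pm_map M r s x) = pm_map N r s (\<phi> r x))))"

definition interval_module :: "real set \<Rightarrow> ('k::field, 'k) pers_module" where
  "interval_module I =
    \<lparr> pm_carrier = (\<lambda>r. if r \<in> I then UNIV else {0}),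
      pm_add = (\<lambda>r. (+)),
      pm_scale = (\<lambda>r. (*)),
      pm_map = (\<lambda>r s x. if r \<in> I \<and> s \<in> I then x else 0) \<rparr>"

text \<open>For a finite index set, the direct sum is the product.\<close>

definition direct_sum ::
    "'j set \<Rightarrow> ('j \<Rightarrow> ('k, 'v) pers_module) \<Rightarrow> ('k, 'j \<Rightarrow> 'v) pers_module" where
  "direct_sum J M =
    \<lparr> pm_carrier = (\<lambda>r. \<Pi>\<^sub>E j\<in>J. pm_carrier (M j) r),
      pm_add = (\<lambda>r x y. \<lambda>j\<in>J. pm_add (M j) r (x j) (y j)),
      pm_scale = (\<lambda>r c x. \<lambda>j\<in>J. pm_scale (M j) r c (x j)),
      pm_map = (\<lambda>r s x. \<lambda>j\<in>J. pm_map (M j) r s (x j)) \<rparr>"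


subsection \<open>Barcodes\<close>

type_synonym barcode = "real set multiset"

definition is_barcode :: "barcode \<Rightarrow> bool" where
  "is_barcode D \<longleftrightarrow> (\<forall>I\<in>#D. is_interval I \<and> I \<noteq> {})"

text \<open>The copies of an interval in a multiset are told apart by a number below its multiplicity.\<close>

definition barcode_module :: "barcode \<Rightarrow> ('k::field, real set \<times> nat \<Rightarrow> 'k) pers_module" where
  "barcode_module D =
    direct_sum {(I, m). m < count D I} (\<lambda>(I, m). interval_module I)"

definition barcode_of :: "('k::field, 'v) pers_module \<Rightarrow> barcode" where
  "barcode_of M = (THE D. is_barcode D \<and> pers_iso M (barcode_module D))"


subsection \<open>Simplicial homology\<close>

text \<open>
  A chain is a vector indexed by all sets of vertices, \<open>axis \<sigma> 1\<close> being the simplex \<open>\<sigma>\<close> oriented by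
  the order of the vertices. The exponent of the sign below is the position of \<open>v\<close> in \<open>\<sigma>\<close>.
\<close>

definition simplex_boundary ::
    "'n::{finite,linorder} set \<Rightarrow> 'k::field ^ ('n set)" where
  "simplex_boundary \<sigma> =
    (if card \<sigma> \<le> 1 then 0
     else \<Sum>v\<in>\<sigma>. (-1) ^ card {w\<in>\<sigma>. w < v} *s axis (\<sigma> - {v}) 1)"

definition boundary_map ::
    "'k::field ^ ('n::{finite,linorder} set) \<Rightarrow> 'k ^ ('n set)" where
  "boundary_map c = (\<Sum>\<sigma>\<in>UNIV. (c $ \<sigma>) *s simplex_boundary \<sigma>)"

definition chains :: "nat \<Rightarrow> 'n::finite set set \<Rightarrow> ('k::field ^ ('n set)) set" where
  "chains l K = {c. \<forall>\<sigma>. c $ \<sigma> \<noteq> 0 \<longrightarrow> \<sigma> \<in> K \<and> card \<sigma> = Suc l}"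

definition cycles ::
    "nat \<Rightarrow> 'n::{finite,linorder} set set \<Rightarrow> ('k::field ^ ('n set)) set" where
  "cycles l K = {c \<in> chains l K. boundary_map c = 0}"

definition boundaries ::
    "nat \<Rightarrow> 'n::{finite,linorder} set set \<Rightarrow> ('k::field ^ ('n set)) set" where
  "boundaries l K = boundary_map ` chains (Suc l) K"

text \<open>
  The homology of a filtration \<open>K\<close> in degree \<open>l\<close>: elements are the cosets \<open>z +o B\<close> with \<open>z\<close> a cycle
  and \<open>B\<close> the boundaries, cosets are added as sets, and adding the boundaries of \<open>K s\<close> to a coset
  for \<open>K r\<close> is the map induced by the inclusion \<open>K r \<subseteq> K s\<close>. Adding the boundaries to a scaled
  coset matters only for the scalar \<open>0\<close>.
\<close>

definition homology_module ::
    "nat \<Rightarrow> (real \<Rightarrow> 'n::{finite,linorder} set set)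
      \<Rightarrow> ('k::field, ('k ^ ('n set)) set) pers_module" where
  "homology_module l K =
    \<lparr> pm_carrier = (\<lambda>r. (\<lambda>z. z +o boundaries l (K r)) ` cycles l (K r)),
      pm_add = (\<lambda>r X Y. X + Y),
      pm_scale = (\<lambda>r c X. (\<lambda>x. c *s x) ` X + boundaries l (K r)),
      pm_map = (\<lambda>r s X. X + boundaries l (K s)) \<rparr>"


subsection \<open>Vietoris--Rips persistence\<close>

definition vietoris_rips :: "real ^ 'd ^ 'n \<Rightarrow> real \<Rightarrow> 'n set set" where
  "vietoris_rips P r = {\<sigma>. \<sigma> \<noteq> {} \<and> (\<forall>i\<in>\<sigma>. \<forall>j\<in>\<sigma>. norm (P $ i - P $ j) \<le> 2 * r)}"

definition PH ::
    "'k::field itself \<Rightarrow> real ^ 'd ^ ('n::{finite,linorder}) \<Rightarrow> nat \<Rightarrow> barcode" where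
  "PH _ P l =
    barcode_of (homology_module l (vietoris_rips P) :: ('k, ('k ^ ('n set)) set) pers_module)"

definition real_endpoint :: "real \<Rightarrow> real set \<Rightarrow> bool" where
  "real_endpoint x I \<longleftrightarrow> (bdd_below I \<and> x = Inf I) \<or> (bdd_above I \<and> x = Sup I)"

definition critical_graph ::
    "'k::field itself \<Rightarrow> real ^ 'd ^ ('n::{finite,linorder}) \<Rightarrow> 'n set set" where
  "critical_graph F P = {{i, j} | i j. i \<noteq> j \<and>
    (\<exists>l. \<exists>I\<in>#PH F P l. real_endpoint (norm (P $ i - P $ j) / 2) I)}"


subsection \<open>Rigidity and local identifiability\<close>

definition congruent_clouds :: "real ^ 'd ^ 'n \<Rightarrow> real ^ 'd ^ 'n \<Rightarrow> bool" where
  "congruent_clouds P Q \<longleftrightarrow> (\<forall>i j. norm (P $ i - P $ j) = norm (Q $ i - Q $ j))"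

definition rigid :: "'n set set \<Rightarrow> real ^ 'd ^ 'n \<Rightarrow> bool" where
  "rigid G P \<longleftrightarrow> (\<exists>U. open U \<and> P \<in> U \<and> (\<forall>Q\<in>U.
    (\<forall>i j. {i, j} \<in> G \<longrightarrow> norm (Q $ i - Q $ j) = norm (P $ i - P $ j)) \<longrightarrow>
    congruent_clouds P Q))"

definition isometric_clouds :: "real ^ 'd ^ 'n \<Rightarrow> real ^ 'd ^ 'n \<Rightarrow> bool" where
  "isometric_clouds P Q \<longleftrightarrow>
    (\<exists>f. bij f \<and> (\<forall>i j. norm (P $ i - P $ j) = norm (Q $ f i - Q $ f j)))"

definition locally_identifiable ::
    "'k::field itself \<Rightarrow> real ^ 'd ^ ('n::{finite,linorder}) \<Rightarrow> bool" where
  "locally_identifiable F P \<longleftrightarrow>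
    (\<exists>U. openin (top_of_set point_clouds) U \<and> P \<in> U \<and>
      (\<forall>Q\<in>U. PH F Q = PH F P \<longrightarrow> isometric_clouds Q P))"

end

theory Submission
  imports Defs "HOL-Library.Function_Algebras"
begin

text \<open>
  The Vietoris--Rips filtration depends on a cloud only through its half distances
  \<open>norm (P $ i - P $ j) / 2\<close>, and only their order matters up to a change of the filtration
  parameter. If the distances of \<open>P\<close> are pairwise distinct, every cloud \<open>Q\<close> near \<open>P\<close> has its distances
  in the same order, so there is an increasing bijection \<open>g\<close> of the line that takes each half
  distance of \<open>Q\<close> to the corresponding one of \<open>P\<close>. The homology of \<open>Q\<close> is then that of \<open>P\<close> with the
  parameter changed by \<open>g\<close>, and the bars of \<open>Q\<close> are the preimages under \<open>g\<close> of the bars of \<open>P\<close>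
  (\<open>PH_reparametrize\<close>).

  Consequently \<open>Q\<close> has the same barcodes as \<open>P\<close> if and only if all critical edges have the same
  length in \<open>Q\<close> as in \<open>P\<close>. In one direction, if the barcodes agree, then \<open>g\<close> permutes the finite set of
  endpoints of each barcode; an increasing map permutes a finite set only trivially, so \<open>g\<close> fixes the
  endpoints (\<open>critical_lengths_if_PH_eq\<close>). In the other direction, every endpoint is a half distance,
  hence \<open>0\<close> or half the length of a critical edge; \<open>g\<close> fixes these and therefore every bar
  (\<open>PH_eq_if_critical_lengths\<close>). With this equivalence, rigidity of the critical graph says
  that the clouds near \<open>P\<close> with the barcodes of \<open>P\<close> are congruent to \<open>P\<close>. Local identifiability says
  the same with isometric in place of congruent, and near \<open>P\<close> an isometry that relabels the points
  changes no distance, because it permutes the set of distances and preserves their order.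

  That the endpoints are half distances follows from uniqueness of barcodes
  (\<open>endpoints_PH_are_half_dists\<close>): a change of parameter that fixes the half distances of \<open>P\<close> does not
  change the filtration, so it must fix the endpoints, but any other point can be moved by such a
  change. Uniqueness itself (\<open>barcode_for_unique\<close>) holds because the number of bars that contain both \<open>r\<close>
  and \<open>s\<close> is the rank of the map from parameter \<open>r\<close> to parameter \<open>s\<close>, and these numbers determine a
  finite multiset of intervals.

  The proper algebraic subset consists of the clouds in which two distances coincide or a half
  distance is, up to sign, an endpoint of the fixed barcode \<open>default_barcode\<close>. The latter is the value that the
  definite description \<open>barcode_of\<close> takes on every module without a barcode, so it does not depend on
  the cloud. A change of parameter preserves the property of having a barcode, so in each degree either both \<open>P\<close>
  and \<open>Q\<close> are described by true barcodes or both have this constant value, whose endpoints then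
  give rise to no critical edge.
\<close>

section \<open>Isomorphisms of persistence modules\<close>

lemma pers_isoI:
  assumes "\<And>r. bij_betw (\<phi> r) (pm_carrier M r) (pm_carrier N r)"
    and "\<And>r x y. x \<in> pm_carrier M r \<Longrightarrow> y \<in> pm_carrier M r \<Longrightarrow>
      \<phi> r (pm_add M r x y) = pm_add N r (\<phi> r x) (\<phi> r y)"
    and "\<And>r c x. x \<in> pm_carrier M r \<Longrightarrow> \<phi> r (pm_scale M r c x) = pm_scale N r c (\<phi> r x)"
    and "\<And>r s x. r \<le> s \<Longrightarrow> x \<in> pm_carrier M r \<Longrightarrow>
      \<phi> s (pm_map M r s x) = pm_map N r s (\<phi> r x)"
  shows "pers_iso M N"
  unfolding pers_iso_def using assms by (intro exI[of _ \<phi>]) blast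

lemma pers_isoE:
  assumes "pers_iso M N"
  obtains \<phi> where "\<And>r. bij_betw (\<phi> r) (pm_carrier M r) (pm_carrier N r)"
    and "\<And>r x y. x \<in> pm_carrier M r \<Longrightarrow> y \<in> pm_carrier M r \<Longrightarrow>
      \<phi> r (pm_add M r x y) = pm_add N r (\<phi> r x) (\<phi> r y)"
    and "\<And>r c x. x \<in> pm_carrier M r \<Longrightarrow> \<phi> r (pm_scale M r c x) = pm_scale N r c (\<phi> r x)"
    and "\<And>r s x. r \<le> s \<Longrightarrow> x \<in> pm_carrier M r \<Longrightarrow>
      \<phi> s (pm_map M r s x) = pm_map N r s (\<phi> r x)"
  using assms unfolding pers_iso_def by blast

lemma pers_iso_trans:
  assumes "pers_iso L M" "pers_iso M N"
  shows "pers_iso L N"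
proof -
  obtain \<phi> where \<phi>: "\<And>r. bij_betw (\<phi> r) (pm_carrier L r) (pm_carrier M r)"
    "\<And>r x y. x \<in> pm_carrier L r \<Longrightarrow> y \<in> pm_carrier L r \<Longrightarrow>
      \<phi> r (pm_add L r x y) = pm_add M r (\<phi> r x) (\<phi> r y)"
    "\<And>r c x. x \<in> pm_carrier L r \<Longrightarrow> \<phi> r (pm_scale L r c x) = pm_scale M r c (\<phi> r x)"
    "\<And>r s x. r \<le> s \<Longrightarrow> x \<in> pm_carrier L r \<Longrightarrow> \<phi> s (pm_map L r s x) = pm_map M r s (\<phi> r x)"
    by (rule pers_isoE[OF assms(1)]) blast
  obtain \<psi> where \<psi>: "\<And>r. bij_betw (\<psi> r) (pm_carrier M r) (pm_carrier N r)"
    "\<And>r x y. x \<in> pm_carrier M r \<Longrightarrow> y \<in> pm_carrier M r \<Longrightarrow>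
      \<psi> r (pm_add M r x y) = pm_add N r (\<psi> r x) (\<psi> r y)"
    "\<And>r c x. x \<in> pm_carrier M r \<Longrightarrow> \<psi> r (pm_scale M r c x) = pm_scale N r c (\<psi> r x)"
    "\<And>r s x. r \<le> s \<Longrightarrow> x \<in> pm_carrier M r \<Longrightarrow> \<psi> s (pm_map M r s x) = pm_map N r s (\<psi> r x)"
    by (rule pers_isoE[OF assms(2)]) blast
  have mem: "\<phi> r x \<in> pm_carrier M r" if "x \<in> pm_carrier L r" for r x
    using \<phi>(1) that by (rule bij_betw_apply)
  show ?thesis
    by (rule pers_isoI[where \<phi> = "\<lambda>r. \<psi> r \<circ> \<phi> r"])
      (auto simp: \<phi>(2-4) \<psi>(2-4) mem intro: bij_betw_trans[OF \<phi>(1) \<psi>(1)])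
qed

text \<open>
  Transporting sums and scalar multiples back along an isomorphism needs a module in which they
  stay inside the carrier, which the record type does not enforce.
\<close>

definition pers_closed :: "('k, 'v) pers_module \<Rightarrow> bool" where
  "pers_closed M \<longleftrightarrow>
    (\<forall>r. \<forall>x\<in>pm_carrier M r. \<forall>y\<in>pm_carrier M r. pm_add M r x y \<in> pm_carrier M r) \<and>
    (\<forall>r c. \<forall>x\<in>pm_carrier M r. pm_scale M r c x \<in> pm_carrier M r) \<and>
    (\<forall>r s. r \<le> s \<longrightarrow> (\<forall>x\<in>pm_carrier M r. pm_map M r s x \<in> pm_carrier M s))"

lemma pers_iso_span:
  assumes closed: "pers_closed M" and "pers_iso M N" "pers_iso M N'"
  shows "pers_iso N N'"
proof -
  obtain \<phi> where \<phi>: "\<And>r. bij_betw (\<phi> r) (pm_carrier M r) (pm_carrier N r)"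
    "\<And>r x y. x \<in> pm_carrier M r \<Longrightarrow> y \<in> pm_carrier M r \<Longrightarrow>
      \<phi> r (pm_add M r x y) = pm_add N r (\<phi> r x) (\<phi> r y)"
    "\<And>r c x. x \<in> pm_carrier M r \<Longrightarrow> \<phi> r (pm_scale M r c x) = pm_scale N r c (\<phi> r x)"
    "\<And>r s x. r \<le> s \<Longrightarrow> x \<in> pm_carrier M r \<Longrightarrow> \<phi> s (pm_map M r s x) = pm_map N r s (\<phi> r x)"
    by (rule pers_isoE[OF assms(2)]) blast
  define \<phi>' where "\<phi>' r = inv_into (pm_carrier M r) (\<phi> r)" for r
  have bij: "bij_betw (\<phi>' r) (pm_carrier N r) (pm_carrier M r)" for r
    unfolding \<phi>'_def using \<phi>(1) by (rule bij_betw_inv_into)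
  have mem: "\<phi>' r x \<in> pm_carrier M r" if "x \<in> pm_carrier N r" for r x
    using bij that by (rule bij_betw_apply)
  have right: "\<phi> r (\<phi>' r x) = x" if "x \<in> pm_carrier N r" for r x
    unfolding \<phi>'_def using \<phi>(1) that by (rule bij_betw_inv_into_right)
  have left: "\<phi>' r u = v" if "v \<in> pm_carrier M r" "u = \<phi> r v" for r u v
    unfolding \<phi>'_def that(2) using \<phi>(1) that(1) by (rule bij_betw_inv_into_left)
  have "pers_iso N M"
    using closed
    by (intro pers_isoI[where \<phi> = \<phi>'] bij left) (auto simp: \<phi>(2-4) mem right pers_closed_def)
  then show ?thesis
    using assms(3) by (rule pers_iso_trans)
qed

lemma direct_sum_reindex:
  assumes bij: "bij_betw \<tau> J' J" and M': "\<And>j. j \<in> J' \<Longrightarrow> M' j = M (\<tau> j)"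
  shows "pers_iso (direct_sum J M) (direct_sum J' M')"
proof (rule pers_isoI[where \<phi> = "\<lambda>r x. \<lambda>j\<in>J'. x (\<tau> j)"])
  have \<tau>: "\<tau> j \<in> J" if "j \<in> J'" for j
    using bij that by (rule bij_betw_apply)
  define \<tau>' where "\<tau>' = inv_into J' \<tau>"
  have \<tau>': "\<tau>' j \<in> J'" "\<tau> (\<tau>' j) = j" if "j \<in> J" for j
    using bij_betw_inv_into[OF bij] bij_betw_inv_into_right[OF bij] that
    unfolding \<tau>'_def by (auto intro: bij_betw_apply)
  have \<tau>\<tau>: "\<tau>' (\<tau> j) = j" if "j \<in> J'" for j
    using bij_betw_inv_into_left[OF bij] that unfolding \<tau>'_def by auto
  show "bij_betw (\<lambda>x. \<lambda>j\<in>J'. x (\<tau> j)) (pm_carrier (direct_sum J M) r)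
    (pm_carrier (direct_sum J' M') r)" for r
  proof (rule bij_betw_byWitness[where f' = "\<lambda>x. \<lambda>j\<in>J. x (\<tau>' j)"])
    show "\<forall>a\<in>pm_carrier (direct_sum J M) r. (\<lambda>j\<in>J. (\<lambda>j\<in>J'. a (\<tau> j)) (\<tau>' j)) = a"
      by (auto simp: direct_sum_def \<tau>' fun_eq_iff PiE_def extensional_def)
    show "\<forall>a\<in>pm_carrier (direct_sum J' M') r. (\<lambda>j\<in>J'. (\<lambda>j\<in>J. a (\<tau>' j)) (\<tau> j)) = a"
      by (auto simp: direct_sum_def \<tau> \<tau>\<tau> fun_eq_iff PiE_def extensional_def)
    show "(\<lambda>x. \<lambda>j\<in>J'. x (\<tau> j)) ` pm_carrier (direct_sum J M) r \<subseteq> pm_carrier (direct_sum J' M') r"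
      by (auto simp: direct_sum_def M' intro!: \<tau>)
    show "(\<lambda>x. \<lambda>j\<in>J. x (\<tau>' j)) ` pm_carrier (direct_sum J' M') r \<subseteq> pm_carrier (direct_sum J M) r"
      using \<tau>' M' by (fastforce simp: direct_sum_def PiE_iff)
  qed
  show "(\<lambda>j\<in>J'. pm_add (direct_sum J M) r x y (\<tau> j)) =
      pm_add (direct_sum J' M') r (\<lambda>j\<in>J'. x (\<tau> j)) (\<lambda>j\<in>J'. y (\<tau> j))" for r x y
    by (auto simp: direct_sum_def \<tau> M' fun_eq_iff)
  show "(\<lambda>j\<in>J'. pm_scale (direct_sum J M) r c x (\<tau> j)) =
      pm_scale (direct_sum J' M') r c (\<lambda>j\<in>J'. x (\<tau> j))" for r c x
    by (auto simp: direct_sum_def \<tau> M' fun_eq_iff)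
  show "(\<lambda>j\<in>J'. pm_map (direct_sum J M) r s x (\<tau> j)) =
      pm_map (direct_sum J' M') r s (\<lambda>j\<in>J'. x (\<tau> j))" for r s x
    by (auto simp: direct_sum_def \<tau> M' fun_eq_iff)
qed


section \<open>Uniqueness of barcodes\<close>

text \<open>
  The index set of \<open>barcode_module D\<close>: the bars of \<open>D\<close>, with multiple copies told apart.
\<close>

definition bars :: "barcode \<Rightarrow> (real set \<times> nat) set" where
  "bars D = {(I, m). m < count D I}"

lemma bars_eq_Sigma: "bars D = (SIGMA I : set_mset D. {..<count D I})"
  by (auto simp: bars_def simp flip: count_greater_zero_iff)

lemma finite_bars: "finite (bars D)"
  unfolding bars_eq_Sigma by auto

lemma card_bars_filter: "card {j \<in> bars D. Q (fst j)} = size (filter_mset Q D)"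
proof -
  have "{j \<in> bars D. Q (fst j)} = bars (filter_mset Q D)"
    by (auto simp: bars_def split: if_splits)
  also have "card \<dots> = size (filter_mset Q D)"
    unfolding bars_eq_Sigma by (simp add: size_multiset_overloaded_eq)
  finally show ?thesis .
qed

lemma sum_fun_apply: "(\<Sum>i\<in>A. f i) x = (\<Sum>i\<in>A. f i x)"
  by (induction A rule: infinite_finite_induct) auto

text \<open>
  Invariance of dimension for coordinate spaces over finite index sets: the images of the unit
  vectors of \<open>S\<close> are independent and lie in the span of the unit vectors of \<open>S'\<close>.
\<close>

lemma injective_linear_card_le:
  fixes T :: "('a \<Rightarrow> 'k::field) \<Rightarrow> 'b \<Rightarrow> 'k"
  assumes fin: "finite S" "finite S'"
    and add: "\<And>x y. T (x + y) = T x + T y"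
    and scale: "\<And>c x. T (\<lambda>j. c * x j) = (\<lambda>j. c * T x j)"
    and supp: "\<And>x j. j \<notin> S' \<Longrightarrow> T x j = 0"
    and inj: "\<And>x. (\<And>j. j \<notin> S \<Longrightarrow> x j = 0) \<Longrightarrow> T x = 0 \<Longrightarrow> x = 0"
  shows "card S \<le> card S'"
proof -
  interpret vector_space "\<lambda>(c::'k) (f::'b \<Rightarrow> 'k) j. c * f j"
    by unfold_locales (auto simp: fun_eq_iff algebra_simps)
  define \<delta> :: "'a \<Rightarrow> 'a \<Rightarrow> 'k" where "\<delta> i = (\<lambda>j. if j = i then 1 else 0)" for i
  define \<epsilon> :: "'b \<Rightarrow> 'b \<Rightarrow> 'k" where "\<epsilon> i = (\<lambda>j. if j = i then 1 else 0)" for i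
  have T0: "T 0 = 0"
    using scale[of 0 0] by (auto simp: fun_eq_iff zero_fun_def)
  have T_sum: "T (\<Sum>i\<in>A. (\<lambda>j. c i * \<delta> i j)) = (\<Sum>i\<in>A. (\<lambda>j. c i * T (\<delta> i) j))"
    if "finite A" for A c
    using that
  proof induction
    case empty
    then show ?case by (simp only: sum.empty T0)
  next
    case (insert a A)
    show ?case
      unfolding sum.insert[OF insert.hyps] add scale insert.IH ..
  qed
  have sum_\<delta>: "(\<Sum>i\<in>S. (\<lambda>j. c i * \<delta> i j)) j = (if j \<in> S then c j else 0)" for c j
    using fin(1) by (simp add: sum_fun_apply \<delta>_def if_distrib cong: if_cong)
  have zero: "c i = 0" if "(\<Sum>i\<in>S. (\<lambda>j. c i * T (\<delta> i) j)) = 0" "i \<in> S" for c i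
  proof -
    have "(\<Sum>i\<in>S. (\<lambda>j. c i * \<delta> i j)) = 0"
      using that(1) by (intro inj) (auto simp: T_sum[OF fin(1)] sum_\<delta>)
    then show ?thesis
      using that(2) sum_\<delta>[of c i] by simp
  qed
  have inj_on: "inj_on (\<lambda>i. T (\<delta> i)) S"
  proof (rule inj_onI, rule ccontr)
    fix i k assume *: "i \<in> S" "k \<in> S" "T (\<delta> i) = T (\<delta> k)" "i \<noteq> k"
    define x where "x = \<delta> i + (\<lambda>j. (-1) * \<delta> k j)"
    have "T x = 0"
      unfolding x_def add scale using *(3) by (auto simp: fun_eq_iff)
    then have "x = 0"
      using *(1,2) by (intro inj) (auto simp: x_def \<delta>_def)
    then show False
      using *(4) by (auto simp: x_def \<delta>_def fun_eq_iff split: if_splits)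
  qed
  have indep: "independent ((\<lambda>i. T (\<delta> i)) ` S)"
  proof (rule independent_if_scalars_zero)
    show "finite ((\<lambda>i. T (\<delta> i)) ` S)"
      using fin by simp
    fix f x
    assume "(\<Sum>x\<in>(\<lambda>i. T (\<delta> i)) ` S. (\<lambda>j. f x * x j)) = 0" "x \<in> (\<lambda>i. T (\<delta> i)) ` S"
    then show "f x = 0"
      using zero[of "\<lambda>i. f (T (\<delta> i))"] by (auto simp: sum.reindex[OF inj_on])
  qed
  have "(\<lambda>i. T (\<delta> i)) ` S \<subseteq> span (\<epsilon> ` S')"
  proof safe
    fix i
    have "T (\<delta> i) = (\<Sum>j'\<in>S'. (\<lambda>j. T (\<delta> i) j' * \<epsilon> j' j))"
      using fin(2) supp by (auto simp: fun_eq_iff sum_fun_apply \<epsilon>_def if_distrib cong: if_cong)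
    moreover have "\<dots> \<in> span (\<epsilon> ` S')"
      by (intro span_sum span_scale span_base) auto
    ultimately show "T (\<delta> i) \<in> span (\<epsilon> ` S')"
      by simp
  qed
  then have "card ((\<lambda>i. T (\<delta> i)) ` S) \<le> card (\<epsilon> ` S')"
    using independent_span_bound[OF _ indep] fin(2) by blast
  also have "\<dots> \<le> card S'"
    using fin(2) by (rule card_image_le)
  finally show ?thesis
    by (simp add: card_image[OF inj_on])
qed

text \<open>
  The bars that contain both \<open>r\<close> and \<open>s\<close> index a basis of the image of the structure map from \<open>r\<close> to \<open>s\<close>.
  An isomorphism commutes with the structure maps and hence embeds one image into the other.
\<close>

lemma barcode_module_iso_size_le:
  fixes D D' :: barcode
  assumes "pers_iso (barcode_module D :: ('k::field, _) pers_module) (barcode_module D')" "r \<le> s"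
  shows "size {#I \<in># D. r \<in> I \<and> s \<in> I#} \<le> size {#I \<in># D'. r \<in> I \<and> s \<in> I#}"
proof -
  let ?M = "barcode_module D :: ('k, _) pers_module"
  let ?M' = "barcode_module D' :: ('k, _) pers_module"
  obtain \<phi> where \<phi>: "\<And>r. bij_betw (\<phi> r) (pm_carrier ?M r) (pm_carrier ?M' r)"
    "\<And>r x y. x \<in> pm_carrier ?M r \<Longrightarrow> y \<in> pm_carrier ?M r \<Longrightarrow>
      \<phi> r (pm_add ?M r x y) = pm_add ?M' r (\<phi> r x) (\<phi> r y)"
    "\<And>r c x. x \<in> pm_carrier ?M r \<Longrightarrow> \<phi> r (pm_scale ?M r c x) = pm_scale ?M' r c (\<phi> r x)"
    "\<And>r s x. r \<le> s \<Longrightarrow> x \<in> pm_carrier ?M r \<Longrightarrow> \<phi> s (pm_map ?M r s x) = pm_map ?M' r s (\<phi> r x)"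
    by (rule pers_isoE[OF assms(1)]) blast
  note defs = barcode_module_def direct_sum_def interval_module_def
    bars_def[symmetric] case_prod_beta
  define S where "S = {j \<in> bars D. r \<in> fst j \<and> s \<in> fst j}"
  define S' where "S' = {j \<in> bars D'. r \<in> fst j \<and> s \<in> fst j}"
  \<comment> \<open>\<open>E x\<close> is the element of the image with coordinates \<open>x\<close>; it lies in the carriers at \<open>r\<close> and at \<open>s\<close>,
    and \<open>T\<close> reads off the coordinates of its image under the isomorphism.\<close>
  define E :: "(real set \<times> nat \<Rightarrow> 'k) \<Rightarrow> real set \<times> nat \<Rightarrow> 'k"
    where "E x = (\<lambda>j\<in>bars D. if j \<in> S then x j else 0)" for x
  define T where "T x = (\<lambda>j. if j \<in> S' then \<phi> s (E x) j else 0)" for x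
  have E_r: "E x \<in> pm_carrier ?M r" and E_s: "E x \<in> pm_carrier ?M s" for x
    by (auto simp: E_def S_def defs)
  have \<phi>E: "\<phi> r (E x) \<in> pm_carrier ?M' r" "\<phi> s (E x) \<in> pm_carrier ?M' s" for x
    using bij_betw_apply[OF \<phi>(1) E_r] bij_betw_apply[OF \<phi>(1) E_s] by blast+
  \<comment> \<open>The structure map fixes \<open>E x\<close>, so its image under \<open>\<phi>\<close> lies in the image of the structure map of
    the second module, and its coordinates vanish off \<open>S'\<close>.\<close>
  have image: "\<phi> s (E x) = pm_map ?M' r s (\<phi> r (E x))" for x
  proof -
    have "pm_map ?M r s (E x) = E x"
      by (auto simp: E_def S_def defs fun_eq_iff)
    then show ?thesis
      using \<phi>(4)[OF assms(2) E_r[of x]] by simp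
  qed
  have off: "\<phi> s (E x) j = 0" if "j \<in> bars D'" "j \<notin> S'" for x j
    using that by (subst image) (auto simp: defs S'_def)
  have "card S \<le> card S'"
  proof (rule injective_linear_card_le[of S S' T])
    show "finite S" "finite S'"
      unfolding S_def S'_def using finite_bars by auto
    show "T (x + y) = T x + T y" for x y
    proof -
      have "E (x + y) = pm_add ?M s (E x) (E y)"
        by (auto simp: E_def S_def defs fun_eq_iff)
      then have "\<phi> s (E (x + y)) = pm_add ?M' s (\<phi> s (E x)) (\<phi> s (E y))"
        by (simp only: \<phi>(2)[OF E_s E_s])
      then show ?thesis
        by (auto simp: T_def S'_def defs fun_eq_iff)
    qed
    show "T (\<lambda>j. c * x j) = (\<lambda>j. c * T x j)" for c x
    proof -
      have "E (\<lambda>j. c * x j) = pm_scale ?M s c (E x)"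
        by (auto simp: E_def S_def defs fun_eq_iff)
      then have "\<phi> s (E (\<lambda>j. c * x j)) = pm_scale ?M' s c (\<phi> s (E x))"
        by (simp only: \<phi>(3)[OF E_s])
      then show ?thesis
        by (auto simp: T_def S'_def defs fun_eq_iff)
    qed
    show "T x j = 0" if "j \<notin> S'" for x j
      using that by (simp add: T_def)
    show "x = 0" if supp: "\<And>j. j \<notin> S \<Longrightarrow> x j = 0" and T0: "T x = 0" for x
    proof -
      have "\<phi> s (E x) = (\<lambda>j\<in>bars D'. 0)"
      proof
        fix j
        show "\<phi> s (E x) j = (\<lambda>j\<in>bars D'. 0) j"
        proof (cases "j \<in> bars D'")
          case True
          then show ?thesis
            using fun_cong[OF T0, of j] off[OF True, of x] by (auto simp: T_def split: if_splits)
        next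
          case False
          then show ?thesis
            using \<phi>E(2)[of x] by (cases j) (auto simp: defs PiE_iff extensional_def)
        qed
      qed
      also have "\<dots> = pm_scale ?M' s 0 (\<phi> s (E 0))"
        by (auto simp: defs fun_eq_iff)
      also have "\<dots> = \<phi> s (pm_scale ?M s 0 (E 0))"
        by (simp add: \<phi>(3)[OF E_s])
      also have "pm_scale ?M s 0 (E 0) = E 0"
        by (auto simp: defs E_def fun_eq_iff)
      finally have E0: "E x = E 0"
        using \<phi>(1)[of s] E_s by (auto simp: bij_betw_def dest: inj_onD)
      have "x j = 0" if "j \<in> S" for j
        using fun_cong[OF E0, of j] that by (simp add: E_def S_def)
      then show ?thesis
        using supp by (auto simp: fun_eq_iff)
    qed
  qed
  then show ?thesis
    unfolding S_def S'_def card_bars_filter[where Q = "\<lambda>I. r \<in> I \<and> s \<in> I"] .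
qed

text \<open>
  Two points of \<open>I\<close> can stand for all of \<open>I\<close> among finitely many intervals: each interval \<open>J\<close> that does
  not contain \<open>I\<close> misses some point of \<open>I\<close>, and the least and the greatest of finitely many such points
  enclose all the others.
\<close>

lemma interval_witnesses:
  fixes I :: "real set"
  assumes "finite \<J>" "\<And>J. J \<in> \<J> \<Longrightarrow> is_interval J" "I \<noteq> {}"
  obtains r s where "r \<le> s" "r \<in> I" "s \<in> I" "\<And>J. J \<in> \<J> \<Longrightarrow> r \<in> J \<Longrightarrow> s \<in> J \<Longrightarrow> I \<subseteq> J"
proof -
  obtain a where a: "a \<in> I"
    using assms(3) by blast
  define f where "f J = (SOME x. x \<in> I - J)" for J
  have f: "f J \<in> I - J" if "\<not> I \<subseteq> J" for J
    unfolding f_def using that by (metis DiffI someI subsetI)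
  define Y where "Y = insert a (f ` {J \<in> \<J>. \<not> I \<subseteq> J})"
  have Y: "finite Y" "Y \<noteq> {}" "Y \<subseteq> I"
    using assms(1) a f by (auto simp: Y_def)
  show ?thesis
  proof
    show "Min Y \<le> Max Y" "Min Y \<in> I" "Max Y \<in> I"
      using Min_in[OF Y(1,2)] Max_in[OF Y(1,2)] Y(1,3) by auto
    show "I \<subseteq> J" if "J \<in> \<J>" "Min Y \<in> J" "Max Y \<in> J" for J
    proof (rule ccontr)
      assume not: "\<not> I \<subseteq> J"
      then have "f J \<in> Y"
        using that(1) by (auto simp: Y_def)
      then have "f J \<in> J"
        using Y that assms(2)[OF that(1)] by (meson Max_ge Min_le mem_is_interval_1_I)
      then show False
        using f[OF not] by blast
    qed
  qed
qed

text \<open>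
  If the multiplicities differ, choose an interval \<open>I\<close> that is maximal among those with different
  multiplicities. For \<open>r\<close> and \<open>s\<close> as in \<open>interval_witnesses\<close> the number of bars through \<open>r\<close> and \<open>s\<close> is the
  number of bars that contain \<open>I\<close>; those that contain \<open>I\<close> properly are equally many on both sides, so
  the multiplicities of \<open>I\<close> agree after all.
\<close>

lemma barcode_eqI:
  assumes "is_barcode D" "is_barcode D'"
    and size: "\<And>r s. r \<le> s \<Longrightarrow>
      size {#I \<in># D. r \<in> I \<and> s \<in> I#} = size {#I \<in># D'. r \<in> I \<and> s \<in> I#}"
  shows "D = D'"
proof (rule ccontr)
  assume "D \<noteq> D'"
  define X where "X = {I. count D I \<noteq> count D' I}"
  have "X \<subseteq> set_mset D \<union> set_mset D'"
    by (auto simp: X_def) (metis not_in_iff)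
  moreover have "X \<noteq> {}"
    using \<open>D \<noteq> D'\<close> by (auto simp: X_def multiset_eq_iff)
  ultimately obtain I where I: "I \<in> X" "\<And>J. J \<in> X \<Longrightarrow> I \<subseteq> J \<Longrightarrow> I = J"
    using finite_has_maximal[of X] by (metis finite_Un finite_set_mset finite_subset)
  have "I \<in># D \<or> I \<in># D'"
    using I(1) \<open>X \<subseteq> _\<close> by auto
  then have "I \<noteq> {}"
    using assms(1,2) by (auto simp: is_barcode_def)
  have intervals: "is_interval J" if "J \<in> set_mset D \<union> set_mset D'" for J
    using assms(1,2) that by (auto simp: is_barcode_def)
  obtain r s where rs: "r \<le> s" "r \<in> I" "s \<in> I"
    "\<And>J. J \<in> set_mset D \<union> set_mset D' \<Longrightarrow> r \<in> J \<Longrightarrow> s \<in> J \<Longrightarrow> I \<subseteq> J"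
    using interval_witnesses[OF _ intervals \<open>I \<noteq> {}\<close>] by (metis finite_Un finite_set_mset)
  have split: "size {#J \<in># C. r \<in> J \<and> s \<in> J#} = count C I + size {#J \<in># C. I \<subset> J#}"
    if "set_mset C \<subseteq> set_mset D \<union> set_mset D'" for C
  proof -
    have "{#J \<in># C. r \<in> J \<and> s \<in> J#} = {#J \<in># C. J = I#} + {#J \<in># C. I \<subset> J#}"
    proof (rule multiset_eqI)
      fix J
      have "r \<in> J \<and> s \<in> J \<longleftrightarrow> J = I \<or> I \<subset> J" if "J \<in># C"
        using rs(2-3) rs(4)[of J] that \<open>set_mset C \<subseteq> _\<close> by blast
      moreover have "count C J = 0" if "J \<notin># C"
        using that by (simp add: not_in_iff)
      ultimately show "count {#J \<in># C. r \<in> J \<and> s \<in> J#} J =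
          count ({#J \<in># C. J = I#} + {#J \<in># C. I \<subset> J#}) J"
        by (cases "J \<in># C") auto
    qed
    then show ?thesis
      by (simp add: filter_eq_replicate_mset)
  qed
  have "{#J \<in># D. I \<subset> J#} = {#J \<in># D'. I \<subset> J#}"
    using I(2) by (intro multiset_eqI) (auto simp: X_def)
  then have "count D I = count D' I"
    using size[OF rs(1)] split[of D] split[of D'] by simp
  then show False
    using I(1) by (simp add: X_def)
qed

definition barcode_for :: "('k::field, 'v) pers_module \<Rightarrow> barcode \<Rightarrow> bool" where
  "barcode_for M D \<longleftrightarrow> is_barcode D \<and> pers_iso M (barcode_module D)"

lemma barcode_for_unique:
  assumes "pers_closed M" "barcode_for M D" "barcode_for M D'"
  shows "D = D'"
proof (rule barcode_eqI)
  show "is_barcode D" "is_barcode D'"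
    using assms by (auto simp: barcode_for_def)
  have "pers_iso M (barcode_module D)" "pers_iso M (barcode_module D')"
    using assms by (auto simp: barcode_for_def)
  then have "pers_iso (barcode_module D :: ('a, _) pers_module) (barcode_module D')"
    "pers_iso (barcode_module D' :: ('a, _) pers_module) (barcode_module D)"
    using pers_iso_span[OF assms(1)] by blast+
  then show "size {#I \<in># D. r \<in> I \<and> s \<in> I#} = size {#I \<in># D'. r \<in> I \<and> s \<in> I#}"
    if "r \<le> s" for r s
    using that by (intro antisym barcode_module_iso_size_le)
qed

lemma barcode_of_eq:
  assumes "pers_closed M" "barcode_for M D"
  shows "barcode_of M = D"
  unfolding barcode_of_def barcode_for_def[symmetric]
  using assms barcode_for_unique by blast

text \<open>
  When a module has no barcode, the description in \<open>barcode_of\<close> is that of an empty predicate; this is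
  its value then, the same for all such modules.
\<close>

definition default_barcode :: barcode where
  "default_barcode = (THE D. False)"

lemma barcode_of_default:
  assumes "\<nexists>D. barcode_for M D"
  shows "barcode_of M = default_barcode"
  using assms unfolding barcode_of_def barcode_for_def[symmetric] default_barcode_def by simp


section \<open>Closure of homology modules\<close>

lemma boundary_map_add: "boundary_map (x + y) = boundary_map x + boundary_map y"
  by (simp add: boundary_map_def vec.scale_left_distrib sum.distrib)

lemma boundary_map_scale: "boundary_map (c *s x) = c *s boundary_map x"
  by (simp add: boundary_map_def vec.scale_sum_right)

lemma subspace_chains: "vec.subspace (chains l K)"
  unfolding vec.subspace_def
proof (intro conjI ballI allI)
  show "x + y \<in> chains l K" if "x \<in> chains l K" "y \<in> chains l K" for x y
    unfolding chains_def
  proof (intro CollectI allI impI)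
    fix \<sigma> assume "(x + y) $ \<sigma> \<noteq> 0"
    then have "x $ \<sigma> \<noteq> 0 \<or> y $ \<sigma> \<noteq> 0"
      by auto
    then show "\<sigma> \<in> K \<and> card \<sigma> = Suc l"
      using that unfolding chains_def by blast
  qed
qed (auto simp: chains_def)

lemma subspace_cycles: "vec.subspace (cycles l K)"
  using subspace_chains[of l K] boundary_map_scale[of 0 0]
  unfolding vec.subspace_def cycles_def by (auto simp: boundary_map_add boundary_map_scale)

lemma subspace_boundaries: "vec.subspace (boundaries l K)"
  unfolding vec.subspace_def
proof (intro conjI ballI allI)
  note closed = subspace_chains[of "Suc l" K, unfolded vec.subspace_def]
  show "0 \<in> boundaries l K"
    using closed boundary_map_scale[of 0 0] unfolding boundaries_def by (metis image_eqI vec.scale_zero_left)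
  show "x + y \<in> boundaries l K" if "x \<in> boundaries l K" "y \<in> boundaries l K" for x y
    using that closed unfolding boundaries_def by (auto simp flip: boundary_map_add)
  show "c *s x \<in> boundaries l K" if "x \<in> boundaries l K" for c x
    using that closed unfolding boundaries_def by (auto simp flip: boundary_map_scale)
qed

text \<open>
  With this, sums of cosets as sets are governed by their representatives.
\<close>

lemma subspace_absorb:
  assumes "vec.subspace B" "0 \<in> X" "X \<subseteq> B"
  shows "X + B = B"
proof
  show "X + B \<subseteq> B"
    using assms(1,3) by (auto simp: vec.subspace_def elim!: set_plus_elim)
  show "B \<subseteq> X + B"
    using assms(2) set_plus_intro[of 0 X _ B] by auto
qed

lemma pers_closed_homology_module:
  assumes "mono K"
  shows "pers_closed (homology_module l K :: ('k::field, _) pers_module)"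
proof -
  let ?Z = "\<lambda>r. cycles l (K r) :: ('k ^ ('a set)) set"
  let ?B = "\<lambda>r. boundaries l (K r) :: ('k ^ ('a set)) set"
  have B: "vec.subspace (?B r)" and Z: "vec.subspace (?Z r)" for r
    by (simp_all add: subspace_boundaries subspace_cycles)
  have zero: "0 \<in> ?B r" for r
    using B by (rule vec.subspace_0)
  have mono: "?Z r \<subseteq> ?Z s" "?B r \<subseteq> ?B s" if "r \<le> s" for r s
    using monoD[OF assms that] by (auto simp: cycles_def boundaries_def chains_def)
  have coset: "z +o X = (\<lambda>b. z + b) ` X" for z and X :: "('k ^ ('a set)) set"
    by (auto simp: elt_set_plus_def)
  have add: "(z +o ?B r) + (w +o ?B r) = (z + w) +o ?B r" for z w r
    by (simp add: set_plus_rearrange subspace_absorb[OF B zero])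
  have map: "(z +o ?B r) + ?B s = z +o ?B s" if "r \<le> s" for z r s
    by (simp add: set_plus_rearrange3 subspace_absorb[OF B zero mono(2)[OF that]])
  have scale: "(\<lambda>x. c *s x) ` (z +o ?B r) + ?B r = (c *s z) +o ?B r" for c z r
  proof -
    have "(\<lambda>x. c *s x) ` (z +o ?B r) = (c *s z) +o (\<lambda>x. c *s x) ` ?B r"
      by (simp add: coset image_image vec.scale_right_distrib)
    moreover have "(\<lambda>x. c *s x) ` ?B r + ?B r = ?B r"
      using B[of r] zero[of r] by (intro subspace_absorb) (auto simp: vec.subspace_def image_iff)
    ultimately show ?thesis
      by (simp add: set_plus_rearrange3)
  qed
  show ?thesis
    using Z mono(1)[THEN subsetD]
    by (auto simp: pers_closed_def homology_module_def add map scale vec.subspace_def intro!: imageI)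
qed


section \<open>Reparametrization\<close>

text \<open>
  The pullback of a persistence module along a change \<open>g\<close> of the parameter. For the modules in use
  here, pulling back along \<open>g\<close> pulls back the underlying filtration or interval, and these
  identities hold by unfolding the definitions.
\<close>

definition reparametrize :: "(real \<Rightarrow> real) \<Rightarrow> ('k, 'v) pers_module \<Rightarrow> ('k, 'v) pers_module" where
  "reparametrize g M =
    \<lparr> pm_carrier = (\<lambda>r. pm_carrier M (g r)),
      pm_add = (\<lambda>r. pm_add M (g r)),
      pm_scale = (\<lambda>r. pm_scale M (g r)),
      pm_map = (\<lambda>r s. pm_map M (g r) (g s)) \<rparr>"

lemma reparametrize_inv:
  "surj g \<Longrightarrow> reparametrize (inv g) (reparametrize g M) = M"
  by (cases M) (simp add: reparametrize_def surj_f_inv_f)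

lemma reparametrize_homology_module:
  "homology_module l (K \<circ> g) = reparametrize g (homology_module l K)"
  by (simp add: homology_module_def reparametrize_def)

lemma reparametrize_direct_sum:
  "reparametrize g (direct_sum J M) = direct_sum J (\<lambda>j. reparametrize g (M j))"
  by (simp add: direct_sum_def reparametrize_def)

lemma reparametrize_interval_module:
  "reparametrize g (interval_module I) = interval_module (g -` I)"
  by (simp add: interval_module_def reparametrize_def)

lemma pers_closed_reparametrize: "mono g \<Longrightarrow> pers_closed M \<Longrightarrow> pers_closed (reparametrize g M)"
  by (auto simp: pers_closed_def reparametrize_def dest: monoD)

lemma pers_iso_reparametrize:
  assumes "mono g" "pers_iso M N"
  shows "pers_iso (reparametrize g M) (reparametrize g N)"
proof -
  obtain \<phi> where \<phi>: "\<And>r. bij_betw (\<phi> r) (pm_carrier M r) (pm_carrier N r)"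
    "\<And>r x y. x \<in> pm_carrier M r \<Longrightarrow> y \<in> pm_carrier M r \<Longrightarrow>
      \<phi> r (pm_add M r x y) = pm_add N r (\<phi> r x) (\<phi> r y)"
    "\<And>r c x. x \<in> pm_carrier M r \<Longrightarrow> \<phi> r (pm_scale M r c x) = pm_scale N r c (\<phi> r x)"
    "\<And>r s x. r \<le> s \<Longrightarrow> x \<in> pm_carrier M r \<Longrightarrow> \<phi> s (pm_map M r s x) = pm_map N r s (\<phi> r x)"
    by (rule pers_isoE[OF assms(2)]) blast
  show ?thesis
    by (rule pers_isoI[where \<phi> = "\<lambda>r. \<phi> (g r)"])
      (auto simp: reparametrize_def \<phi> monoD[OF assms(1)])
qed

lemma pers_iso_reparametrize_barcode_module:
  assumes g: "inj g" "surj g"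
  shows "pers_iso (reparametrize g (barcode_module D)) (barcode_module (image_mset (vimage g) D))"
proof -
  have count: "count (image_mset (vimage g) D) J = count D (g ` J)" for J
  proof -
    have "g -` I = J \<longleftrightarrow> I = g ` J" for I
      using inj_vimage_image_eq[OF g(1)] surj_image_vimage_eq[OF g(2)] by auto
    then show ?thesis
      by (induction D) auto
  qed
  have "bij_betw (\<lambda>(J, m). (g ` J, m)) (bars (image_mset (vimage g) D)) (bars D)"
    by (rule bij_betw_byWitness[where f' = "\<lambda>(I, m). (g -` I, m)"])
      (auto simp: bars_def count inj_vimage_image_eq[OF g(1)] g(2))
  then show ?thesis
    unfolding barcode_module_def bars_def[symmetric] reparametrize_direct_sum
    by (rule direct_sum_reindex)
      (auto simp: reparametrize_interval_module inj_vimage_image_eq[OF g(1)])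
qed

lemma barcode_for_reparametrize:
  assumes g: "strict_mono g" "surj g" and D: "barcode_for M D"
  shows "barcode_for (reparametrize g M) (image_mset (vimage g) D)"
proof -
  have "is_interval (g -` I)" "g -` I \<noteq> {}" if "I \<in># D" for I
  proof -
    have I: "is_interval I" "I \<noteq> {}"
      using D that by (auto simp: barcode_for_def is_barcode_def)
    then show "is_interval (g -` I)"
      using strict_mono_mono[OF g(1)] unfolding is_interval_1 vimage_def by (blast dest: monoD)
    show "g -` I \<noteq> {}"
      using I(2) g(2) by (metis image_empty surj_image_vimage_eq)
  qed
  moreover have "pers_iso (reparametrize g M) (barcode_module (image_mset (vimage g) D))"
    using D g strict_mono_imp_inj_on[OF g(1)]
    by (intro pers_iso_trans[OF pers_iso_reparametrize pers_iso_reparametrize_barcode_module])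
      (auto simp: barcode_for_def intro: strict_mono_mono)
  ultimately show ?thesis
    by (auto simp: barcode_for_def is_barcode_def)
qed

lemma barcode_of_reparametrize:
  assumes "strict_mono g" "surj g" "pers_closed M" "barcode_for M D"
  shows "barcode_of (reparametrize g M) = image_mset (vimage g) D"
  using assms
  by (intro barcode_of_eq pers_closed_reparametrize barcode_for_reparametrize strict_mono_mono)

text \<open>
  A barcode of the pullback along \<open>g\<close> would give a barcode of the module itself by pulling back
  further along the inverse of \<open>g\<close>.
\<close>

lemma barcode_of_reparametrize_default:
  assumes "strict_mono g" "surj g" "\<nexists>D. barcode_for M D"
  shows "barcode_of (reparametrize g M) = default_barcode"
proof (rule barcode_of_default, rule notI, elim exE)
  fix D assume "barcode_for (reparametrize g M) D"
  moreover have "strict_mono (inv g)"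
    using surj_f_inv_f[OF assms(2)] strict_mono_less[OF assms(1)]
    by (intro strict_monoI) metis
  moreover have "surj (inv g)"
    using assms(1) by (intro inj_imp_surj_inv strict_mono_imp_inj_on)
  ultimately show False
    using barcode_for_reparametrize[of "inv g" "reparametrize g M" D] assms(3)
    by (auto simp: reparametrize_inv[OF assms(2)])
qed

text \<open>
  Induction adds a new greatest point \<open>b\<close>. The extension \<open>g\<close> obtained so far may have the wrong value at
  \<open>b\<close>; composing it with a map that is the identity up to a level \<open>c\<close> and stretches the half-line above
  \<open>c\<close> corrects this without changing the values at the earlier points.
\<close>

lemma strict_mono_extension:
  fixes f :: "real \<Rightarrow> real"
  assumes "finite X" "strict_mono_on X f"
  obtains g where "strict_mono g" "surj g" "\<And>x. x \<in> X \<Longrightarrow> g x = f x"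
proof -
  have "\<exists>g. strict_mono g \<and> surj g \<and> (\<forall>x\<in>X. g x = f x)"
    using assms
  proof (induction X rule: finite_linorder_max_induct)
    case empty
    show ?case
      by (intro exI[of _ id]) (auto simp: strict_mono_def)
  next
    case (insert b A)
    then obtain g where g: "strict_mono g" "surj g" "\<forall>x\<in>A. g x = f x"
      using monotone_on_subset[OF insert.prems subset_insertI] by blast
    obtain c where c: "c < g b" "c < f b" "\<forall>x\<in>A. g x \<le> c"
    proof (cases "A = {}")
      case True
      then show ?thesis
        using that[of "min (g b) (f b) - 1"] by auto
    next
      case False
      then have "Max A \<in> A"
        using insert.hyps by simp
      then have "Max A < b" "f (Max A) < f b"
        using insert.hyps(2) strict_mono_onD[OF insert.prems] by auto
      moreover have "g (Max A) = f (Max A)"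
        using g(3) \<open>Max A \<in> A\<close> by blast
      moreover have "\<forall>x\<in>A. g x \<le> g (Max A)"
        using insert.hyps(1) by (simp add: strict_mono_less_eq[OF g(1)])
      ultimately show ?thesis
        using that[of "g (Max A)"] strict_mono_less[OF g(1)] by metis
    qed
    define t where "t = (f b - c) / (g b - c)"
    have t: "t > 0" "c + t * (g b - c) = f b"
      using c by (auto simp: t_def)
    define k where "k y = (if y \<le> c then y else c + t * (y - c))" for y
    have "strict_mono k"
    proof (rule strict_monoI)
      fix x y :: real assume "x < y"
      moreover have "t * (x - c) < t * (y - c)"
        using t \<open>x < y\<close> by simp
      moreover have "0 < t * (y - c)" if "c < y"
        using t that by simp
      ultimately show "k x < k y"
        by (auto simp: k_def)
    qed
    moreover have "surj k"
    proof (rule surjI)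
      show "k (if y \<le> c then y else c + (y - c) / t) = y" for y
        using t by (auto simp: k_def divide_le_0_iff)
    qed
    moreover have "k (g b) = f b" "\<forall>x\<in>A. k (g x) = f x"
      using c t g(3) by (auto simp: k_def)
    ultimately show ?case
      using g by (intro exI[of _ "k \<circ> g"] conjI strict_mono_o comp_surj) auto
  qed
  then show ?thesis
    using that by blast
qed


section \<open>Endpoints\<close>

definition endpoints :: "barcode \<Rightarrow> real set" where
  "endpoints D = {x. \<exists>I\<in>#D. real_endpoint x I}"

lemma finite_endpoints: "finite (endpoints D)"
proof (rule finite_subset)
  show "endpoints D \<subseteq> Inf ` set_mset D \<union> Sup ` set_mset D"
    by (auto simp: endpoints_def real_endpoint_def)
qed auto

text \<open>
  Endpoints in terms of the order alone, which is what an increasing bijection preserves.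
\<close>

lemma real_endpoint_iff_bounds:
  assumes "I \<noteq> {}"
  shows "real_endpoint x I \<longleftrightarrow>
    (\<forall>y. (\<forall>z\<in>I. y \<le> z) \<longleftrightarrow> y \<le> x) \<or> (\<forall>y. (\<forall>z\<in>I. z \<le> y) \<longleftrightarrow> x \<le> y)"
proof -
  have "bdd_below I \<and> x = Inf I \<longleftrightarrow> (\<forall>y. (\<forall>z\<in>I. y \<le> z) \<longleftrightarrow> y \<le> x)"
  proof
    assume R: "\<forall>y. (\<forall>z\<in>I. y \<le> z) \<longleftrightarrow> y \<le> x"
    then have "bdd_below I"
      by (meson bdd_belowI order_refl)
    moreover have "x = Inf I"
      using R \<open>bdd_below I\<close> assms by (metis le_cInf_iff order_antisym order_refl)
    ultimately show "bdd_below I \<and> x = Inf I" ..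
  qed (use assms in \<open>auto simp: le_cInf_iff\<close>)
  moreover have "bdd_above I \<and> x = Sup I \<longleftrightarrow> (\<forall>y. (\<forall>z\<in>I. z \<le> y) \<longleftrightarrow> x \<le> y)"
  proof
    assume R: "\<forall>y. (\<forall>z\<in>I. z \<le> y) \<longleftrightarrow> x \<le> y"
    then have "bdd_above I"
      by (meson bdd_aboveI order_refl)
    moreover have "x = Sup I"
      using R \<open>bdd_above I\<close> assms by (metis cSup_le_iff order_antisym order_refl)
    ultimately show "bdd_above I \<and> x = Sup I" ..
  qed (use assms in \<open>auto simp: cSup_le_iff\<close>)
  ultimately show ?thesis
    by (simp add: real_endpoint_def)
qed

lemma real_endpoint_vimage:
  fixes g :: "real \<Rightarrow> real"
  assumes g: "strict_mono g" "surj g" and "I \<noteq> {}"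
  shows "real_endpoint x (g -` I) \<longleftrightarrow> real_endpoint (g x) I"
proof -
  have all: "(\<forall>y. Q (g y)) \<longleftrightarrow> (\<forall>y. Q y)" for Q
    using g(2) by (metis surjD)
  have ball: "(\<forall>z\<in>g -` I. Q (g z)) \<longleftrightarrow> (\<forall>z\<in>I. Q z)" for Q
    using all[of "\<lambda>z. z \<in> I \<longrightarrow> Q z"] by auto
  have ne: "g -` I \<noteq> {}"
    using assms(3) g(2) by (metis image_empty surj_image_vimage_eq)
  have "(\<forall>y. (\<forall>z\<in>g -` I. y \<le> z) \<longleftrightarrow> y \<le> x) \<longleftrightarrow>
      (\<forall>y. (\<forall>z\<in>g -` I. g y \<le> g z) \<longleftrightarrow> g y \<le> g x)"
    by (simp add: strict_mono_less_eq[OF g(1)])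
  also have "\<dots> \<longleftrightarrow> (\<forall>y. (\<forall>z\<in>I. y \<le> z) \<longleftrightarrow> y \<le> g x)"
    unfolding ball[of "\<lambda>z. g y \<le> z" for y] by (rule all)
  finally have lower: "(\<forall>y. (\<forall>z\<in>g -` I. y \<le> z) \<longleftrightarrow> y \<le> x) \<longleftrightarrow>
    (\<forall>y. (\<forall>z\<in>I. y \<le> z) \<longleftrightarrow> y \<le> g x)" .
  have "(\<forall>y. (\<forall>z\<in>g -` I. z \<le> y) \<longleftrightarrow> x \<le> y) \<longleftrightarrow>
      (\<forall>y. (\<forall>z\<in>g -` I. g z \<le> g y) \<longleftrightarrow> g x \<le> g y)"
    by (simp add: strict_mono_less_eq[OF g(1)])
  also have "\<dots> \<longleftrightarrow> (\<forall>y. (\<forall>z\<in>I. z \<le> y) \<longleftrightarrow> g x \<le> y)"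
    unfolding ball[of "\<lambda>z. z \<le> g y" for y] by (rule all)
  finally have upper: "(\<forall>y. (\<forall>z\<in>g -` I. z \<le> y) \<longleftrightarrow> x \<le> y) \<longleftrightarrow>
    (\<forall>y. (\<forall>z\<in>I. z \<le> y) \<longleftrightarrow> g x \<le> y)" .
  show ?thesis
    unfolding real_endpoint_iff_bounds[OF assms(3)] real_endpoint_iff_bounds[OF ne] lower upper ..
qed

lemma endpoints_vimage:
  fixes g :: "real \<Rightarrow> real"
  assumes "strict_mono g" "surj g" "is_barcode D"
  shows "endpoints (image_mset (vimage g) D) = g -` endpoints D"
  using assms(3) by (auto simp: endpoints_def is_barcode_def real_endpoint_vimage[OF assms(1,2)])

text \<open>
  The map permutes \<open>E\<close> and preserves the order, so as many points of \<open>E\<close> lie below \<open>g x\<close> as below \<open>x\<close>.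
\<close>

lemma strict_mono_fixes_finite:
  fixes g :: "real \<Rightarrow> real"
  assumes "finite E" "strict_mono g" "g ` E \<subseteq> E" "x \<in> E"
  shows "g x = x"
proof -
  have inj: "inj_on g A" for A
    using assms(2) by (rule strict_mono_imp_inj_on[THEN inj_on_subset]) (rule subset_UNIV)
  have "g ` E = E"
    using assms(1,3) inj by (rule endo_inj_surj)
  have "{y \<in> E. y \<le> g x} = g ` {y \<in> E. y \<le> x}"
  proof (intro equalityI subsetI)
    fix y assume "y \<in> {y \<in> E. y \<le> g x}"
    then obtain z where "z \<in> E" "y = g z" "g z \<le> g x"
      using \<open>g ` E = E\<close> by auto
    then show "y \<in> g ` {y \<in> E. y \<le> x}"
      by (simp add: strict_mono_less_eq[OF assms(2)])
  qed (use assms(3) in \<open>auto simp: strict_mono_less_eq[OF assms(2)]\<close>)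
  then have card: "card {y \<in> E. y \<le> g x} = card {y \<in> E. y \<le> x}"
    by (simp add: card_image[OF inj])
  have less: "card {y \<in> E. y \<le> a} < card {y \<in> E. y \<le> b}" if "a < b" "b \<in> E" for a b
  proof (rule psubset_card_mono)
    have "b \<in> {y \<in> E. y \<le> b} - {y \<in> E. y \<le> a}" "{y \<in> E. y \<le> a} \<subseteq> {y \<in> E. y \<le> b}"
      using that by auto
    then show "{y \<in> E. y \<le> a} \<subset> {y \<in> E. y \<le> b}"
      by blast
  qed (use assms(1) in simp)
  show ?thesis
    using less[of x "g x"] less[of "g x" x] assms(3,4) card by (cases x "g x" rule: linorder_cases) auto
qed

lemma real_endpoint_between:
  assumes "is_interval I" "a < b" "a \<in> I \<longleftrightarrow> b \<notin> I"
  obtains e where "real_endpoint e I" "a \<le> e" "e \<le> b"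
proof (cases "a \<in> I")
  case True
  then have ub: "z \<le> b" if "z \<in> I" for z
    using assms that by (meson is_interval_1 linear less_imp_le)
  then have "bdd_above I" "a \<le> Sup I" "Sup I \<le> b"
    using True by (auto intro!: bdd_aboveI cSup_upper cSup_least)
  then show ?thesis
    using that[of "Sup I"] by (simp add: real_endpoint_def)
next
  case False
  then have "b \<in> I"
    using assms(3) by simp
  then have lb: "a \<le> z" if "z \<in> I" for z
    using assms that False by (meson is_interval_1 linear less_imp_le)
  then have "bdd_below I" "a \<le> Inf I" "Inf I \<le> b"
    using \<open>b \<in> I\<close> by (auto intro!: bdd_belowI cInf_lower cInf_greatest)
  then show ?thesis
    using that[of "Inf I"] by (simp add: real_endpoint_def)
qed

text \<open>
  If \<open>g\<close> carried a point across the boundary of \<open>I\<close>, then an endpoint would lie between the point and its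
  image; but a fixed point cannot lie between another point and its image under an increasing map.
\<close>

lemma vimage_interval_fixed:
  fixes g :: "real \<Rightarrow> real"
  assumes "strict_mono g" "is_interval I" and fixed: "\<And>x. real_endpoint x I \<Longrightarrow> g x = x"
  shows "g -` I = I"
proof -
  have "r \<in> I \<longleftrightarrow> g r \<in> I" for r
  proof (rule ccontr)
    assume neq: "(r \<in> I) \<noteq> (g r \<in> I)"
    have "min r (g r) < max r (g r)" "min r (g r) \<in> I \<longleftrightarrow> max r (g r) \<notin> I"
      using neq by (cases r "g r" rule: linorder_cases; force simp: min_def max_def)+
    then obtain e where e: "real_endpoint e I" "min r (g r) \<le> e" "e \<le> max r (g r)"
      by (rule real_endpoint_between[OF assms(2)])
    have "g e = e"
      using fixed e(1) .
    then have "e = r"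
      using e(2,3) strict_mono_less[OF assms(1), of e r] strict_mono_less[OF assms(1), of r e]
      by (cases "r \<le> g r") (auto simp: min_def max_def)
    then show False
      using neq \<open>g e = e\<close> by simp
  qed
  then show ?thesis
    by auto
qed


section \<open>Vietoris--Rips barcodes under reparametrization\<close>

definition half_dist :: "real ^ 'd ^ 'n \<Rightarrow> 'n \<Rightarrow> 'n \<Rightarrow> real" where
  "half_dist P i j = norm (P $ i - P $ j) / 2"

definition rips_homology ::
    "'k::field itself \<Rightarrow> real ^ 'd ^ ('n::{finite,linorder}) \<Rightarrow> nat
      \<Rightarrow> ('k, ('k ^ ('n set)) set) pers_module" where
  "rips_homology F P l = homology_module l (vietoris_rips P)"

lemma PH_eq_barcode_of: "PH F P l = barcode_of (rips_homology F P l)"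
  by (simp add: PH_def rips_homology_def)

lemma pers_closed_rips_homology: "pers_closed (rips_homology F P l)"
  unfolding rips_homology_def
  by (rule pers_closed_homology_module) (force intro!: monoI simp: vietoris_rips_def)

lemma vietoris_rips_half_dist:
  "vietoris_rips P r = {\<sigma>. \<sigma> \<noteq> {} \<and> (\<forall>i\<in>\<sigma>. \<forall>j\<in>\<sigma>. half_dist P i j \<le> r)}"
  by (simp add: vietoris_rips_def half_dist_def mult.commute)

lemma rips_homology_reparametrize:
  assumes "strict_mono g" "\<And>i j. g (half_dist Q i j) = half_dist P i j"
  shows "rips_homology F Q l = reparametrize g (rips_homology F P l)"
proof -
  have "vietoris_rips Q = vietoris_rips P \<circ> g"
    by (auto simp: fun_eq_iff vietoris_rips_half_dist strict_mono_less_eq[OF assms(1)]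
        simp flip: assms(2))
  then show ?thesis
    by (simp add: rips_homology_def reparametrize_homology_module)
qed

lemma PH_reparametrize:
  assumes "strict_mono g" "surj g" "\<And>i j. g (half_dist Q i j) = half_dist P i j"
    and "barcode_for (rips_homology F P l) D"
  shows "PH F Q l = image_mset (vimage g) D"
  unfolding PH_eq_barcode_of rips_homology_reparametrize[OF assms(1,3)]
  using assms(1,2) pers_closed_rips_homology assms(4) by (rule barcode_of_reparametrize)

lemma PH_reparametrize_default:
  assumes "strict_mono g" "surj g" "\<And>i j. g (half_dist Q i j) = half_dist P i j"
    and "\<nexists>D. barcode_for (rips_homology F P l) D"
  shows "PH F Q l = default_barcode"
  unfolding PH_eq_barcode_of rips_homology_reparametrize[OF assms(1,3)]
  using assms(1,2,4) by (rule barcode_of_reparametrize_default)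

lemma PH_eq: "barcode_for (rips_homology F P l) D \<Longrightarrow> PH F P l = D"
  unfolding PH_eq_barcode_of using pers_closed_rips_homology by (rule barcode_of_eq)

lemma PH_eq_default: "\<nexists>D. barcode_for (rips_homology F P l) D \<Longrightarrow> PH F P l = default_barcode"
  unfolding PH_eq_barcode_of by (rule barcode_of_default)

text \<open>
  An increasing bijection that fixes all half distances of \<open>P\<close> leaves the filtration unchanged, so by
  uniqueness it preserves the barcode and fixes its finitely many endpoints. An
  endpoint \<open>x\<close> that is not a half distance could be moved by such a bijection.
\<close>

lemma endpoints_PH_are_half_dists:
  assumes "barcode_for (rips_homology F P l) D" "x \<in> endpoints D"
  shows "\<exists>i j. x = half_dist P i j"
proof (rule ccontr)
  define X where "X = (\<lambda>(i, j). half_dist P i j) ` UNIV"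
  assume not: "\<nexists>i j. x = half_dist P i j"
  have "finite X"
    by (simp add: X_def)
  then obtain d where d: "d > 0" "\<And>y. y \<in> X \<Longrightarrow> y \<noteq> x \<Longrightarrow> d \<le> dist x y"
    using finite_set_avoid[of X x] by metis
  have gap: "y \<le> x - d \<or> x + d \<le> y" if "y \<in> X" for y
    using d(2)[OF that] that not by (force simp: X_def dist_real_def abs_if split: if_splits)
  \<comment> \<open>No half distance lies within \<open>d\<close> of \<open>x\<close>, so \<open>x\<close> can be shifted by \<open>d / 2\<close> without passing one.\<close>
  define f where "f y = (if y = x then x + d / 2 else y)" for y
  have "strict_mono_on (insert x X) f"
    using d(1) by (intro strict_mono_onI) (auto simp: f_def dest!: gap)
  then obtain g where g: "strict_mono g" "surj g" "\<And>y. y \<in> insert x X \<Longrightarrow> g y = f y"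
    using strict_mono_extension[of "insert x X" f] \<open>finite X\<close> by auto
  have "g (half_dist P i j) = half_dist P i j" for i j
    using g(3)[of "half_dist P i j"] not by (force simp: X_def f_def)
  then have "D = image_mset (vimage g) D"
    using PH_reparametrize[OF g(1,2) _ assms(1), of P] PH_eq[OF assms(1)] by simp
  then have "endpoints D = g -` endpoints D"
    using endpoints_vimage[OF g(1,2)] assms(1) by (metis barcode_for_def)
  then have "g x = x"
    using assms(2) by (intro strict_mono_fixes_finite[OF finite_endpoints g(1)]) auto
  then show False
    using g(3)[of x] d(1) by (simp add: f_def)
qed


section \<open>Clouds with the same order of distances\<close>

definition same_order :: "real ^ 'd ^ 'n \<Rightarrow> real ^ 'd ^ 'n \<Rightarrow> bool" where
  "same_order P Q \<longleftrightarrow>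
    (\<forall>i j k l. half_dist P i j < half_dist P k l \<longleftrightarrow> half_dist Q i j < half_dist Q k l)"

lemma same_order_reparametrization:
  fixes P Q :: "real ^ 'd ^ 'n"
  assumes "same_order P Q"
  obtains g where "strict_mono g" "surj g" "\<And>i j. g (half_dist Q i j) = half_dist P i j"
proof -
  define u where "u = (\<lambda>(i, j). half_dist Q i j)"
  define v where "v = (\<lambda>(i, j). half_dist P i j)"
  have less: "u e < u e' \<longleftrightarrow> v e < v e'" for e e'
    using assms by (auto simp: u_def v_def same_order_def split: prod.splits)
  have eq: "v (inv u (u e)) = v e" for e
    using less[of e "inv u (u e)"] less[of "inv u (u e)" e] f_inv_into_f[of "u e" u UNIV] by simp
  have "strict_mono_on (range u) (v \<circ> inv u)"
    by (intro strict_mono_onI) (auto simp: eq less)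
  moreover have "finite (range u)"
    by simp
  ultimately obtain g where g: "strict_mono g" "surj g"
    "\<And>x. x \<in> range u \<Longrightarrow> g x = (v \<circ> inv u) x"
    using strict_mono_extension by blast
  have "g (u e) = v e" for e
    using g(3)[of "u e"] eq by simp
  from this[of "(_, _)"] show ?thesis
    using that[OF g(1,2)] by (simp add: u_def v_def)
qed

text \<open>
  The hypothesis \<open>avoid\<close> ensures that a critical edge comes from a degree in which \<open>P\<close> has a true barcode.
  That barcode is invariant under \<open>g\<close>, so \<open>g\<close> permutes its endpoints and fixes them.
\<close>

lemma critical_lengths_if_PH_eq:
  assumes "same_order P Q"
    and avoid: "\<And>i j. i \<noteq> j \<Longrightarrow> half_dist P i j \<notin> endpoints default_barcode"
    and PH: "PH F Q = PH F P" and "{i, j} \<in> critical_graph F P"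
  shows "half_dist Q i j = half_dist P i j"
proof -
  obtain g where g: "strict_mono g" "surj g" "\<And>i j. g (half_dist Q i j) = half_dist P i j"
    using same_order_reparametrization[OF assms(1)] by blast
  obtain i' j' l where "i' \<noteq> j'" and ij: "{i, j} = {i', j'}"
    and "half_dist P i' j' \<in> endpoints (PH F P l)"
    using assms(4) unfolding critical_graph_def endpoints_def half_dist_def by blast
  moreover have "half_dist P i j = half_dist P i' j'"
    using ij by (auto simp: half_dist_def norm_minus_commute doubleton_eq_iff)
  ultimately have "i \<noteq> j" and endpt: "half_dist P i j \<in> endpoints (PH F P l)"
    using ij by (auto simp: doubleton_eq_iff)
  then obtain D where D: "barcode_for (rips_homology F P l) D"
    using avoid PH_eq_default[of F P l] by metis
  have "D = image_mset (vimage g) D"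
    using PH_reparametrize[OF g D] PH_eq[OF D] PH by simp
  then have "endpoints D = g -` endpoints D"
    using endpoints_vimage[OF g(1,2)] D by (metis barcode_for_def)
  then have "g (half_dist P i j) = half_dist P i j"
    using endpt PH_eq[OF D] by (intro strict_mono_fixes_finite[OF finite_endpoints[of D] g(1)]) auto
  then show ?thesis
    using g(3)[of i j] strict_mono_eq[OF g(1)] by metis
qed

text \<open>
  The endpoints of a true barcode of \<open>P\<close> are \<open>0\<close> and half lengths of critical edges. So \<open>g\<close> fixes them,
  and the bars of \<open>Q\<close>, which are the preimages of the bars of \<open>P\<close> under \<open>g\<close>, are those of \<open>P\<close>.
\<close>

lemma PH_eq_if_critical_lengths:
  assumes "same_order P Q"
    and lengths: "\<And>i j. {i, j} \<in> critical_graph F P \<Longrightarrow> half_dist Q i j = half_dist P i j"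
  shows "PH F Q = PH F P"
proof
  fix l
  obtain g where g: "strict_mono g" "surj g" "\<And>i j. g (half_dist Q i j) = half_dist P i j"
    using same_order_reparametrization[OF assms(1)] by blast
  show "PH F Q l = PH F P l"
  proof (cases "\<exists>D. barcode_for (rips_homology F P l) D")
    case True
    then obtain D where D: "barcode_for (rips_homology F P l) D" ..
    have fixed: "g x = x" if x: "x \<in> endpoints D" for x
    proof -
      obtain i j where ij: "x = half_dist P i j"
        using endpoints_PH_are_half_dists[OF D x] by blast
      have "half_dist Q i j = half_dist P i j"
      proof (cases "i = j")
        case False
        \<comment> \<open>An endpoint is half the length of a critical edge, by definition of the critical graph.\<close>
        then have "{i, j} \<in> critical_graph F P"
          using x PH_eq[OF D] unfolding critical_graph_def endpoints_def ij half_dist_def by blast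
        then show ?thesis
          by (rule lengths)
      qed (simp add: half_dist_def)
      then show ?thesis
        using g(3)[of i j] ij by simp
    qed
    have "g -` I = I" if "I \<in># D" for I
    proof (rule vimage_interval_fixed[OF g(1)])
      show "is_interval I"
        using D that by (auto simp: barcode_for_def is_barcode_def)
      show "g x = x" if "real_endpoint x I" for x
        using that \<open>I \<in># D\<close> by (intro fixed) (auto simp: endpoints_def)
    qed
    then have "image_mset (vimage g) D = image_mset id D"
      by (intro image_mset_cong) simp
    then show ?thesis
      using PH_reparametrize[OF g D] PH_eq[OF D] by simp
  next
    case False
    then show ?thesis
      using PH_reparametrize_default[OF g False] PH_eq_default[OF False] by simp
  qed
qed

text \<open>
  An isometry makes the sets of half distances of \<open>P\<close> and \<open>Q\<close> equal, so \<open>g\<close> maps this finite set to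
  itself and hence fixes each element.
\<close>

lemma isometric_same_order_congruent:
  assumes "same_order P Q" "isometric_clouds Q P"
  shows "congruent_clouds P Q"
proof -
  obtain g where g: "strict_mono g" "surj g" "\<And>i j. g (half_dist Q i j) = half_dist P i j"
    using same_order_reparametrization[OF assms(1)] by blast
  obtain f where f: "bij f" "\<And>i j. half_dist Q i j = half_dist P (f i) (f j)"
    using assms(2) by (auto simp: isometric_clouds_def half_dist_def)
  define X where "X = (\<lambda>(i, j). half_dist Q i j) ` UNIV"
  have "half_dist P i j \<in> X" for i j
    using f(2)[of "inv f i" "inv f j"] bij_is_surj[OF f(1)]
    by (auto simp: X_def surj_f_inv_f intro!: image_eqI[of _ _ "(inv f i, inv f j)"])
  then have "g ` X \<subseteq> X"
    by (auto simp: X_def g(3))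
  moreover have "finite X"
    by (simp add: X_def)
  ultimately have "g x = x" if "x \<in> X" for x
    using g(1) that strict_mono_fixes_finite by blast
  moreover have "half_dist Q i j \<in> X" for i j
    unfolding X_def by (rule image_eqI[of _ _ "(i, j)"]) auto
  ultimately have "half_dist P i j = half_dist Q i j" for i j
    using g(3)[of i j] by simp
  then show ?thesis
    by (simp add: congruent_clouds_def half_dist_def)
qed

definition distinct_distances :: "real ^ 'd ^ 'n \<Rightarrow> bool" where
  "distinct_distances P \<longleftrightarrow> (\<forall>i j k l. i \<noteq> j \<longrightarrow> k \<noteq> l \<longrightarrow> {i, j} \<noteq> {k, l} \<longrightarrow>
    half_dist P i j \<noteq> half_dist P k l)"

text \<open>
  Finitely many strict inequalities between distances persist under small perturbations. For equal half
  distances there is nothing to perturb: as the distances are distinct, both belong to the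
  same pair of points or both are \<open>0\<close>.
\<close>

lemma same_order_neighborhood:
  fixes P :: "real ^ 'd ^ 'n"
  assumes "P \<in> point_clouds" "distinct_distances P"
  obtains U where "open U" "P \<in> U" "U \<subseteq> point_clouds" "\<And>Q. Q \<in> U \<Longrightarrow> same_order P Q"
proof
  define T where "T = {(i, j, k, l). half_dist P i j < half_dist P k l}"
  define U where "U = (\<Inter>(i, j, k, l)\<in>T. {Q :: real ^ 'd ^ 'n. half_dist Q i j < half_dist Q k l})"
  show "open U"
    unfolding U_def half_dist_def
    by (intro open_INT finite) (auto intro!: open_Collect_less continuous_intros)
  show "P \<in> U"
    by (auto simp: U_def T_def)
  have mono: "half_dist Q i j < half_dist Q k l"
    if "Q \<in> U" "half_dist P i j < half_dist P k l" for Q i j k l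
    using that by (auto simp: U_def T_def)
  have pos: "0 < half_dist P i j \<longleftrightarrow> i \<noteq> j" for i j
    using assms(1) by (auto simp: half_dist_def point_clouds_def)
  have zero: "half_dist Q i i = 0" for Q :: "real ^ 'd ^ 'n" and i
    by (simp add: half_dist_def)
  show "U \<subseteq> point_clouds"
  proof
    fix Q assume Q: "Q \<in> U"
    have "0 < half_dist Q i j" if "i \<noteq> j" for i j
      using mono[OF Q, of i i i j] pos that by (simp add: zero)
    then show "Q \<in> point_clouds"
      by (force simp: point_clouds_def half_dist_def)
  qed
  show "same_order P Q" if Q: "Q \<in> U" for Q
  proof -
    have eq: "half_dist Q i j = half_dist Q k l" if "half_dist P i j = half_dist P k l" for i j k l
    proof (cases "i = j")
      case True
      then have "k = l"
        using that pos[of k l] by (auto simp: zero)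
      then show ?thesis
        using True by (simp add: zero)
    next
      case False
      then have "k \<noteq> l"
        using that pos[of i j] by (auto simp: zero)
      then have "{i, j} = {k, l}"
        using False that assms(2) unfolding distinct_distances_def by blast
      then show ?thesis
        by (auto simp: doubleton_eq_iff half_dist_def norm_minus_commute)
    qed
    show ?thesis
      unfolding same_order_def
    proof (intro allI iffI)
      fix i j k l
      assume "half_dist Q i j < half_dist Q k l"
      then show "half_dist P i j < half_dist P k l"
        using eq[of i j k l] mono[OF Q, of k l i j]
        by (cases "half_dist P i j" "half_dist P k l" rule: linorder_cases) auto
    qed (rule mono[OF Q])
  qed
qed

lemma locally_identifiable_iff_rigid:
  fixes P :: "real ^ 'd ^ ('n::{finite,linorder})"
  assumes "P \<in> point_clouds" "distinct_distances P"
    and avoid: "\<And>i j. i \<noteq> j \<Longrightarrow> half_dist P i j \<notin> endpoints default_barcode"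
  shows "locally_identifiable F P \<longleftrightarrow> rigid (critical_graph F P) P"
proof -
  obtain N where N: "open N" "P \<in> N" "N \<subseteq> point_clouds" "\<And>Q. Q \<in> N \<Longrightarrow> same_order P Q"
    using same_order_neighborhood[OF assms(1,2)] by blast
  have PH_iff: "PH F Q = PH F P \<longleftrightarrow>
      (\<forall>i j. {i, j} \<in> critical_graph F P \<longrightarrow> norm (Q $ i - Q $ j) = norm (P $ i - P $ j))"
    if "Q \<in> N" for Q
    using critical_lengths_if_PH_eq[OF N(4)[OF that] avoid, of F]
      PH_eq_if_critical_lengths[OF N(4)[OF that], of F]
    by (auto simp: half_dist_def)
  show ?thesis
  proof
    assume "locally_identifiable F P"
    then obtain T where T: "open T" "P \<in> T"
      "\<And>Q. Q \<in> T \<Longrightarrow> Q \<in> point_clouds \<Longrightarrow> PH F Q = PH F P \<Longrightarrow> isometric_clouds Q P"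
      unfolding locally_identifiable_def openin_open by blast
    have "congruent_clouds P Q" if "Q \<in> T \<inter> N" "PH F Q = PH F P" for Q
      using that T(3) N(3,4) by (blast intro: isometric_same_order_congruent)
    then show "rigid (critical_graph F P) P"
      unfolding rigid_def using T(1,2) N(1,2) PH_iff by (intro exI[of _ "T \<inter> N"]) auto
  next
    assume "rigid (critical_graph F P) P"
    then obtain T where T: "open T" "P \<in> T"
      "\<And>Q. Q \<in> T \<Longrightarrow> (\<forall>i j. {i, j} \<in> critical_graph F P \<longrightarrow>
        norm (Q $ i - Q $ j) = norm (P $ i - P $ j)) \<Longrightarrow> congruent_clouds P Q"
      unfolding rigid_def by blast
    have "isometric_clouds Q P" if "Q \<in> T \<inter> N" "PH F Q = PH F P" for Q
    proof -
      have "congruent_clouds P Q"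
        using that PH_iff T(3) by blast
      then show ?thesis
        unfolding isometric_clouds_def congruent_clouds_def by (intro exI[of _ id]) auto
    qed
    moreover have "openin (top_of_set point_clouds) (T \<inter> N)"
      using T(1) N(1,3) by (metis inf.coboundedI2 open_Int open_subset)
    ultimately show "locally_identifiable F P"
      unfolding locally_identifiable_def using T(2) N(2) by blast
  qed
qed


section \<open>Genericity\<close>

lemma real_polynomial_function_dist_squared:
  "real_polynomial_function (\<lambda>P :: real ^ 'd ^ 'n. (norm (P $ i - P $ j))\<^sup>2)"
proof -
  have "(norm (P $ i - P $ j))\<^sup>2 = (\<Sum>k\<in>UNIV. (P $ i $ k - P $ j $ k)\<^sup>2)" for P :: "real ^ 'd ^ 'n"
    by (simp add: norm_vec_def L2_set_def sum_nonneg)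
  moreover have "real_polynomial_function (\<lambda>P :: real ^ 'd ^ 'n. P $ i $ k)" for i k
    by (intro real_polynomial_function.intros(1) bounded_linear_compose[OF bounded_linear_vec_nth]
        bounded_linear_vec_nth)
  ultimately show ?thesis
    by (auto intro!: real_polynomial_function_sum real_polynomial_function_power
        real_polynomial_function_diff)
qed

text \<open>
  A difference \<open>3 ^ a - 3 ^ b\<close> with \<open>b < a\<close> lies between \<open>2 * 3 ^ (a - 1)\<close> and \<open>3 ^ a\<close>, so it
  determines \<open>a\<close>.
\<close>

lemma power3_diff_eqD:
  fixes a b c e :: nat
  assumes "b < a" "e < c" "(3::real) ^ a - 3 ^ b = 3 ^ c - 3 ^ e"
  shows "a = c \<and> b = e"
proof -
  have bound: "\<not> c < a" if "b < a" "e < c" "(3::real) ^ a - 3 ^ b = 3 ^ c - 3 ^ e" for a b c e :: nat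
  proof
    assume "c < a"
    then obtain m where m: "a = Suc m" "b \<le> m" "c \<le> m"
      using \<open>b < a\<close> by (cases a) auto
    have "(3::real) ^ b \<le> 3 ^ m" "(3::real) ^ c \<le> 3 ^ m" "(0::real) < 3 ^ e" "(0::real) < 3 ^ m"
      using m by (auto intro: power_increasing)
    moreover have "(3::real) * 3 ^ m - 3 ^ b = 3 ^ c - 3 ^ e"
      using that(3) m(1) by simp
    ultimately show False
      by linarith
  qed
  have "a = c"
    using bound[of b a e c] bound[of e c b a] assms by (metis linorder_neqE)
  then show ?thesis
    using assms(3) by simp
qed

text \<open>
  Put the points on a line at the positions \<open>t * 3 ^ k\<close> for distinct \<open>k\<close>. The distances are distinct
  by \<open>power3_diff_eqD\<close> and at least \<open>2 * t\<close>, so for large \<open>t\<close> the half distances exceed all of \<open>E\<close>.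
\<close>

lemma generic_cloud_exists:
  fixes E :: "real set"
  assumes "finite E"
  obtains P :: "real ^ 'd ^ 'n" where "distinct_distances P"
    and "\<And>i j. i \<noteq> j \<Longrightarrow> half_dist P i j \<notin> E"
proof -
  obtain \<iota> :: "'n \<Rightarrow> nat" where \<iota>: "inj \<iota>"
    using finite_imp_inj_to_nat_seg[of "UNIV :: 'n set"] by auto
  obtain b :: "real ^ 'd" where b: "norm b = 1"
    using vector_choose_size[of 1] by auto
  define t where "t = 1 + (\<Sum>x\<in>E. \<bar>x\<bar>)"
  have t: "t > 0" "\<And>x. x \<in> E \<Longrightarrow> x < t"
  proof -
    show "t > 0"
      by (simp add: t_def add_pos_nonneg sum_nonneg)
    show "x < t" if "x \<in> E" for x
      using member_le_sum[OF that, of abs] assms by (simp add: t_def)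
  qed
  define P :: "real ^ 'd ^ 'n" where "P = (\<chi> i. (t * 3 ^ \<iota> i) *\<^sub>R b)"
  have sym: "half_dist P i j = half_dist P j i" for i j
    by (simp add: half_dist_def norm_minus_commute)
  have dist: "half_dist P i j = t / 2 * (3 ^ \<iota> i - 3 ^ \<iota> j)" if "\<iota> j < \<iota> i" for i j
  proof -
    have "(3::real) ^ \<iota> j < 3 ^ \<iota> i"
      using that by simp
    moreover have "half_dist P i j = norm ((t * (3 ^ \<iota> i - 3 ^ \<iota> j)) *\<^sub>R b) / 2"
      by (simp add: P_def half_dist_def algebra_simps)
    ultimately show ?thesis
      using t(1) by (simp add: b abs_mult)
  qed
  have oriented: "\<exists>i' j'. {i, j} = {i', j'} \<and> half_dist P i j = half_dist P i' j' \<and> \<iota> j' < \<iota> i'"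
    if "i \<noteq> j" for i j
    using that sym[of i j] injD[OF \<iota>, of i j] by (metis insert_commute linorder_neqE_nat)
  show ?thesis
  proof
    show "distinct_distances P"
      unfolding distinct_distances_def
    proof (intro allI impI notI)
      fix i j k l
      assume ne: "i \<noteq> j" "k \<noteq> l" "{i, j} \<noteq> {k, l}" and eq: "half_dist P i j = half_dist P k l"
      obtain i' j' where ij: "{i, j} = {i', j'}" "half_dist P i j = half_dist P i' j'" "\<iota> j' < \<iota> i'"
        using oriented[OF ne(1)] by blast
      obtain k' l' where kl: "{k, l} = {k', l'}" "half_dist P k l = half_dist P k' l'" "\<iota> l' < \<iota> k'"
        using oriented[OF ne(2)] by blast
      have "(3::real) ^ \<iota> i' - 3 ^ \<iota> j' = 3 ^ \<iota> k' - 3 ^ \<iota> l'"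
        using eq t(1) by (simp add: ij(2) kl(2) dist ij(3) kl(3))
      then have "\<iota> i' = \<iota> k' \<and> \<iota> j' = \<iota> l'"
        by (rule power3_diff_eqD[OF ij(3) kl(3)])
      then show False
        using ne(3) ij(1) kl(1) \<iota> by (simp add: inj_eq)
    qed
    show "half_dist P i j \<notin> E" if ne: "i \<noteq> j" for i j
    proof
      assume "half_dist P i j \<in> E"
      then have "half_dist P i j < t"
        by (rule t(2))
      obtain i' j' where ij: "half_dist P i j = half_dist P i' j'" "\<iota> j' < \<iota> i'"
        using oriented[OF ne] by blast
      obtain m where m: "\<iota> i' = Suc m" "\<iota> j' \<le> m"
        using ij(2) by (cases "\<iota> i'") auto
      have "(3::real) ^ \<iota> j' \<le> 3 ^ m" "(1::real) \<le> 3 ^ m"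
        using m by (auto intro: power_increasing)
      then have "2 \<le> (3::real) ^ \<iota> i' - 3 ^ \<iota> j'"
        unfolding m(1) power_Suc by linarith
      then have "t / 2 * 2 \<le> half_dist P i' j'"
        unfolding dist[OF ij(2)] using t(1) by (intro mult_left_mono) auto
      then show False
        using \<open>half_dist P i j < t\<close> ij(1) by simp
    qed
  qed
qed

text \<open>
  The squared distances are polynomials in the coordinates, and the product of all the polynomials
  that must not vanish is a single polynomial, nonzero at the cloud of \<open>generic_cloud_exists\<close>. Squares
  do not see signs, so that cloud is taken to avoid the absolute values of the elements of \<open>E\<close>.
\<close>

lemma generic_clouds_algebraic:
  fixes E :: "real set"
  assumes "finite E"
  obtains A :: "(real ^ 'd ^ 'n) set" where "algebraic_set A" "A \<noteq> UNIV"
    and "\<And>P. P \<notin> A \<Longrightarrow> distinct_distances P"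
    and "\<And>P i j. P \<notin> A \<Longrightarrow> i \<noteq> j \<Longrightarrow> half_dist P i j \<notin> E"
proof -
  define T where "T = {(i :: 'n, j, k, l). i \<noteq> j \<and> k \<noteq> l \<and> {i, j} \<noteq> {k, l}}"
  define S where "S = {(i :: 'n, j). i \<noteq> j} \<times> E"
  define p where "p P = (\<Prod>(i, j, k, l)\<in>T. (norm (P $ i - P $ j))\<^sup>2 - (norm (P $ k - P $ l))\<^sup>2) *
    (\<Prod>((i, j), x)\<in>S. (norm (P $ i - P $ j))\<^sup>2 - (2 * x)\<^sup>2)" for P :: "real ^ 'd ^ 'n"
  have "finite T"
    by (rule finite)
  have "finite S"
    unfolding S_def using assms by (intro finite_cartesian_product finite)
  have nonzero: "p P \<noteq> 0 \<longleftrightarrow>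
      (\<forall>(i, j, k, l)\<in>T. (norm (P $ i - P $ j))\<^sup>2 \<noteq> (norm (P $ k - P $ l))\<^sup>2) \<and>
      (\<forall>((i, j), x)\<in>S. (norm (P $ i - P $ j))\<^sup>2 \<noteq> (2 * x)\<^sup>2)" for P
    using \<open>finite T\<close> \<open>finite S\<close> by (auto simp: p_def prod_zero_iff split: prod.splits)
  have "real_polynomial_function p"
    unfolding p_def case_prod_beta
    using \<open>finite T\<close> \<open>finite S\<close>
    by (intro real_polynomial_function.intros(2,4) real_polynomial_function_prod
        real_polynomial_function_diff real_polynomial_function_dist_squared)
  then have "algebraic_set {P. p P = 0}"
    unfolding algebraic_set_def by (intro exI[of _ "{p}"]) auto
  moreover have "{P. p P = 0} \<noteq> UNIV"
  proof -
    obtain P :: "real ^ 'd ^ 'n" where P: "distinct_distances P"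
      "\<And>i j. i \<noteq> j \<Longrightarrow> half_dist P i j \<notin> (\<lambda>x. \<bar>x\<bar>) ` E"
      using generic_cloud_exists[of "(\<lambda>x. \<bar>x\<bar>) ` E"] assms by blast
    have "(norm (P $ i - P $ j))\<^sup>2 \<noteq> (2 * x)\<^sup>2" if "i \<noteq> j" "x \<in> E" for i j x
    proof
      assume "(norm (P $ i - P $ j))\<^sup>2 = (2 * x)\<^sup>2"
      then have "norm (P $ i - P $ j) = 2 * x \<or> norm (P $ i - P $ j) = - (2 * x)"
        by (simp only: power2_eq_iff)
      then have "half_dist P i j = \<bar>x\<bar>"
        using norm_ge_zero[of "P $ i - P $ j"] unfolding half_dist_def by linarith
      then show False
        using P(2)[OF that(1)] that(2) by simp
    qed
    moreover have "(norm (P $ i - P $ j))\<^sup>2 \<noteq> (norm (P $ k - P $ l))\<^sup>2"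
      if "(i, j, k, l) \<in> T" for i j k l
      using that P(1) by (auto simp: T_def distinct_distances_def half_dist_def)
    ultimately have "p P \<noteq> 0"
      unfolding nonzero by (auto simp: S_def)
    then show ?thesis
      by auto
  qed
  moreover have "distinct_distances P" if "P \<notin> {P. p P = 0}" for P
  proof -
    have "\<forall>(i, j, k, l)\<in>T. (norm (P $ i - P $ j))\<^sup>2 \<noteq> (norm (P $ k - P $ l))\<^sup>2"
      using that nonzero by blast
    then show ?thesis
      unfolding distinct_distances_def T_def half_dist_def by fastforce
  qed
  moreover have "half_dist P i j \<notin> E" if "P \<notin> {P. p P = 0}" "i \<noteq> j" for P i j
  proof
    assume "half_dist P i j \<in> E"
    then have mem: "((i, j), half_dist P i j) \<in> S"
      using that(2) by (simp add: S_def)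
    have "\<forall>((i, j), x)\<in>S. (norm (P $ i - P $ j))\<^sup>2 \<noteq> (2 * x)\<^sup>2"
      using that(1) nonzero by blast
    from bspec[OF this mem] show False
      by (simp add: half_dist_def power_divide)
  qed
  ultimately show ?thesis
    using that by blast
qed

theorem theorem58:
  shows "\<exists>A :: (real ^ 'd ^ ('n::{finite,linorder})) set. algebraic_set A \<and> A \<noteq> UNIV \<and>
    (\<forall>P \<in> point_clouds - A.
      locally_identifiable TYPE('k::field) P \<longleftrightarrow> rigid (critical_graph TYPE('k) P) P)"
proof -
  obtain A :: "(real ^ 'd ^ ('n::{finite,linorder})) set" where A: "algebraic_set A" "A \<noteq> UNIV"
    "\<And>P. P \<notin> A \<Longrightarrow> distinct_distances P"
    "\<And>P i j. P \<notin> A \<Longrightarrow> i \<noteq> j \<Longrightarrow> half_dist P i j \<notin> endpoints default_barcode"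
    using generic_clouds_algebraic[OF finite_endpoints] by blast
  show ?thesis
  proof (intro exI[of _ A] conjI A(1,2) ballI)
    fix P assume "P \<in> point_clouds - A"
    then show "locally_identifiable TYPE('k) P \<longleftrightarrow> rigid (critical_graph TYPE('k) P) P"
      by (intro locally_identifiable_iff_rigid A(3,4)) auto
  qed
qed

end
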